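(* There exist absolute constants $c,C>0$ such that the following holds. Let $\Delta,\lambda,r>0$ be such that the class of positive definite matrices $\Sigma\in\mathbb{R}^{p\times p}$ with $r(\Sigma^2)=r$ and $\|\Sigma\|_\infty=\lambda$ is nonempty. Then $$\inf_{\hat\eta}\ \sup_{r(\Sigma^2)=r,\ \|\Sigma\|_\infty=\lambda}\ \ \sup_{\|\theta\|^2\ge \Delta^2\lambda}\ \mathbf{E}\big(\mathcal{R}_\Sigma(\hat\eta)\big)\ \ge\ C\exp\left(-c\,\frac{\Delta^4}{\Delta^2+\frac{r}{n}}\right),$$ where the infimum is taken over all measurable classifiers $\hat\eta$, the first supremum is over positive definite $\Sigma\in\mathbb{R}^{p\times p}$ and the second over $\theta\in\mathbb{R}^p$.
   Context: Model (Gaussian noise). $n,p\ge 1$ are integers. One observes pairs $(Y_i,\eta_i)$, $i=1,\dots,n$, with $Y_i=\theta\eta_i+W_i\in\mathbb{R}^p$, where $\theta\in\mathbb{R}^p$ is an unknown center vector, $\eta=(\eta_1,\dots,\eta_n)^\top\in\{-1,1\}^n$ is a label vector not depending on the noise, and $W_1,\dots,W_n$ are i.i.d. $\mathcal{N}(0,\Sigma)$ with $\Sigma$ of full rank (positive definite). Write $(\mathbf{Y},\eta)=((Y_1,\eta_1),\dots,(Y_n,\eta_n))$ for the training data. A new observation $(Y_{n+1},\eta_{n+1})$, independent of the training data, satisfies $Y_{n+1}=\theta\eta_{n+1}+W_{n+1}$, with $\eta_{n+1}$ uniform on $\{-1,1\}$ and independent of $W_{n+1}\sim\mathcal{N}(0,\Sigma)$.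 A classifier is a measurable map $\hat\eta$ of the training data and of the new observation with values in $\{-1,1\}$; its generalization error is $\mathcal{R}_\Sigma(\hat\eta)=\mathbb{P}\big(\hat\eta((\mathbf{Y},\eta);Y_{n+1})\ne\eta_{n+1}\mid(\mathbf{Y},\eta)\big)$, so that $\mathbf{E}(\mathcal{R}_\Sigma(\hat\eta))=\mathbb{P}(\hat\eta((\mathbf{Y},\eta);Y_{n+1})\neq\eta_{n+1})$. Notation: $\|\theta\|$ is the Euclidean norm; for a positive semidefinite nonzero matrix $A$, $\|A\|_\infty$ is its largest eigenvalue (spectral norm) and $r(A)=\operatorname{Tr}(A)/\|A\|_\infty$ is its effective rank. *)

theory Defs
  imports
    "HOL-Probability.Probability"
    "Jordan_Normal_Form.Spectral_Radius"
    "Jordan_Normal_Form.Gauss_Jordan_Elimination"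
begin

text \<open>
  The dimension \<open>p\<close> and the sample size \<open>n\<close> have to be quantified inside the scope of the absolute
  constants, so they are natural numbers and not types.  Matrices are those of
  Jordan_Normal_Form; a vector of \<open>\<real>\<^sup>p\<close> that is observed, or that parametrises a law, is a function
  on \<open>{..<p}\<close>, extended by \<^const>\<open>undefined\<close>, so that \<open>\<real>\<^sup>p\<close> is the product space
  \<open>\<Pi>\<^sub>M j\<in>{..<p}. borel\<close>.
\<close>

definition pos_def_mat :: "nat \<Rightarrow> real mat \<Rightarrow> bool" where
  "pos_def_mat p A \<longleftrightarrow> A \<in> carrier_mat p p \<and> transpose_mat A = A \<and>
     (\<forall>v\<in>carrier_vec p. v \<noteq> 0\<^sub>v p \<longrightarrow> scalar_prod v (A *\<^sub>v v) > 0)"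

definition mat_tr :: "real mat \<Rightarrow> real" where
  "mat_tr A = (\<Sum>i<dim_row A. A $$ (i, i))"

text \<open>This is the spectral norm for the positive semidefinite matrices only.\<close>

definition max_eigenvalue :: "real mat \<Rightarrow> real" where
  "max_eigenvalue A = Max (spectrum A)"

definition effective_rank :: "real mat \<Rightarrow> real" where
  "effective_rank A = mat_tr A / max_eigenvalue A"

definition cov_class :: "nat \<Rightarrow> real \<Rightarrow> real \<Rightarrow> real mat set" where
  "cov_class p l r =
     {S. pos_def_mat p S \<and> effective_rank (S * S) = r \<and> max_eigenvalue S = l}"

definition euclid_norm :: "nat \<Rightarrow> (nat \<Rightarrow> real) \<Rightarrow> real" where
  "euclid_norm p x = L2_set x {..<p}"

definition center_class :: "nat \<Rightarrow> real \<Rightarrow> (nat \<Rightarrow> real) set" where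
  "center_class p a = {\<theta> \<in> {..<p} \<rightarrow>\<^sub>E UNIV. (euclid_norm p \<theta>)\<^sup>2 \<ge> a}"

text \<open>
  \<open>\<N>(0, S)\<close>, given by its density; the formula is meaningful for positive definite \<open>S\<close>, in which
  case \<^const>\<open>mat_inverse\<close> does return the inverse.
\<close>

definition gaussian :: "nat \<Rightarrow> real mat \<Rightarrow> (nat \<Rightarrow> real) measure" where
  "gaussian p S = density (\<Pi>\<^sub>M j\<in>{..<p}. lborel)
     (\<lambda>x. ennreal (exp (- scalar_prod (Matrix.vec p x) (the (mat_inverse S) *\<^sub>v Matrix.vec p x) / 2)
                   / sqrt ((2 * pi) ^ p * Determinant.det S)))"

definition obs_space :: "nat \<Rightarrow> (nat \<Rightarrow> real) measure" where
  "obs_space p = (\<Pi>\<^sub>M j\<in>{..<p}. borel)"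

definition label_space :: "real measure" where
  "label_space = count_space {-1, 1}"

definition labels_space :: "nat \<Rightarrow> (nat \<Rightarrow> real) measure" where
  "labels_space n = (\<Pi>\<^sub>M i\<in>{..<n}. label_space)"

definition data_space :: "nat \<Rightarrow> nat \<Rightarrow> (nat \<Rightarrow> (nat \<Rightarrow> real) \<times> real) measure" where
  "data_space n p = (\<Pi>\<^sub>M i\<in>{..<n}. obs_space p \<Otimes>\<^sub>M label_space)"

definition observe :: "nat \<Rightarrow> (nat \<Rightarrow> real) \<Rightarrow> real \<Rightarrow> (nat \<Rightarrow> real) \<Rightarrow> (nat \<Rightarrow> real)" where
  "observe p \<theta> e w = (\<lambda>j\<in>{..<p}. \<theta> j * e + w j)"

text \<open>
  Law of the training data when the label vector has law \<open>\<nu>\<close> and is independent of the noise.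
  A deterministic label vector is the case of a Dirac measure \<open>\<nu>\<close>.
\<close>

definition training_law ::
  "nat \<Rightarrow> nat \<Rightarrow> (nat \<Rightarrow> real) measure \<Rightarrow> real mat \<Rightarrow> (nat \<Rightarrow> real)
     \<Rightarrow> (nat \<Rightarrow> (nat \<Rightarrow> real) \<times> real) measure" where
  "training_law n p \<nu> S \<theta> =
     distr (\<nu> \<Otimes>\<^sub>M (\<Pi>\<^sub>M i\<in>{..<n}. gaussian p S)) (data_space n p)
       (\<lambda>(\<eta>, W). \<lambda>i\<in>{..<n}. (observe p \<theta> (\<eta> i) (W i), \<eta> i))"

definition classifiers ::
  "nat \<Rightarrow> nat \<Rightarrow> ((nat \<Rightarrow> (nat \<Rightarrow> real) \<times> real) \<times> (nat \<Rightarrow> real) \<Rightarrow> real) set" where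
  "classifiers n p = measurable (data_space n p \<Otimes>\<^sub>M obs_space p) label_space"

text \<open>
  The conditional error probability given that the training data are \<open>D\<close>: as the new label and the
  new noise vector are independent of the training data, conditioning amounts to freezing \<open>D\<close>.
\<close>

definition gen_error ::
  "nat \<Rightarrow> real mat \<Rightarrow> (nat \<Rightarrow> real)
     \<Rightarrow> ((nat \<Rightarrow> (nat \<Rightarrow> real) \<times> real) \<times> (nat \<Rightarrow> real) \<Rightarrow> real)
     \<Rightarrow> (nat \<Rightarrow> (nat \<Rightarrow> real) \<times> real) \<Rightarrow> real" where
  "gen_error p S \<theta> h D =
     (let M = uniform_count_measure {-1, 1} \<Otimes>\<^sub>M gaussian p S
      in measure M {(e, w) \<in> space M. h (D, observe p \<theta> e w) \<noteq> e})"

definition expected_gen_error ::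
  "nat \<Rightarrow> nat \<Rightarrow> (nat \<Rightarrow> real) measure \<Rightarrow> real mat \<Rightarrow> (nat \<Rightarrow> real)
     \<Rightarrow> ((nat \<Rightarrow> (nat \<Rightarrow> real) \<times> real) \<times> (nat \<Rightarrow> real) \<Rightarrow> real) \<Rightarrow> real" where
  "expected_gen_error n p \<nu> S \<theta> h = (\<integral>D. gen_error p S \<theta> h D \<partial>training_law n p \<nu> S \<theta>)"

end

theory Submission
  imports Defs
begin

text \<open>
  The class of covariance matrices is replaced by one diagonal matrix, with entry \<open>l\<close> in the first
  place and \<open>mu = l * sqrt ((r - 1) / (p - 1))\<close> in the others; that it belongs to the class as
  soon as the class is nonempty follows from \<open>1 < r \<le> p\<close> (or \<open>p = r = 1\<close>), a fact on the
  eigenvalues of \<open>S * S\<close> (\<open>effective_rank_bounds\<close>).  Its noise has independent coordinates.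

  The supremum over centers is bounded below by the average over \<open>\<theta> j = a j * s j\<close> with uniform
  random signs \<open>s j\<close> and a fixed vector \<open>a\<close> of squared norm \<open>\<Delta>\<^sup>2 * l\<close>.  All laws are written as
  densities with respect to the law of the pure noise, where a shift becomes an exponential factor
  (\<open>nn_integral_shift\<close>).  Averaging over the signs makes the density of the sample and of a new
  observation with label \<open>e\<close> proportional to the product over \<open>j\<close> of \<open>cosh (x j + e * y j)\<close>; here
  \<open>x j\<close> is the normalised sum of the \<open>j\<close>-th coordinates of the training sample, each multiplied by
  its label, and \<open>y j\<close> is the normalised \<open>j\<close>-th coordinate of the new observation.  The classifier
  has to tell \<open>e = 1\<close> from \<open>e = -1\<close>, so twice its average error is at least the integral of the
  minimum of the two densities.

  This integral is bounded through the reference density \<open>g0\<close>, proportional to the product of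
  \<open>cosh (x j) * cosh (y j)\<close>, under which the sample and the new observation carry independent signs.
  If the two densities satisfy \<open>g0\<^sup>2 * exp (- 2 * X) \<le> g1 * g2\<close> and \<open>X\<close> has mean at most \<open>m\<close> under
  \<open>g0\<close>, then the testing error is at least of the order of \<open>exp (- 2 * m)\<close>: this is Le Cam's
  inequality between overlap and Hellinger affinity together with Jensen's inequality, both in the form
  of their tangent lines, so that only integrals of nonnegative functions occur
  (\<open>min_ge_affine_overlap\<close>, \<open>mixture_test_error\<close>).

  Two choices of \<open>a\<close> and \<open>X\<close> give the rate.  Write \<open>E\<close> for \<open>\<Delta> ^ 4 / (\<Delta>\<^sup>2 + r / n)\<close>.  If \<open>r < 2\<close>
  or \<open>r < 2 * n * \<Delta>\<^sup>2\<close>, then \<open>\<Delta>\<^sup>2\<close> is at most a multiple of \<open>E\<close> plus a constant; put the center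
  on the first coordinate and use that \<open>cosh (x + y) * cosh (x - y)\<close> loses no more than
  \<open>exp (- 2 * \<bar>y\<bar>)\<close> against \<open>(cosh x * cosh y)\<^sup>2\<close>, where \<open>\<bar>y 0\<bar>\<close> has mean at most
  \<open>\<Delta>\<^sup>2 + 1\<close>.
  Otherwise spread the center evenly over the other coordinates; the loss is then at most
  \<open>exp (- 6 * x\<^sup>2 * y\<^sup>2)\<close> in each of them, and the sum of the means of \<open>3 * x\<^sup>2 * y\<^sup>2\<close> is at most of the
  order of \<open>n * \<Delta> ^ 4 / r\<close>.

  The suprema are taken in the reals, hence are meaningful only for bounded families.  Boundedness
  by one requires that \<open>gaussian p S\<close> has mass one for every positive definite \<open>S\<close>
  (\<open>prob_space_gaussian\<close>), which is shown by eliminating one coordinate at a time.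
\<close>

section \<open>Total mass of the Gaussian density\<close>

lemma quadratic_form_sum:
  assumes "A \<in> carrier_mat p p"
  shows "scalar_prod (Matrix.vec p x) (A *\<^sub>v Matrix.vec p x)
    = (\<Sum>i<p. \<Sum>j<p. A $$ (i, j) * x i * (x j :: real))"
  using assms
  by (auto simp: scalar_prod_def mult_mat_vec_def lessThan_atLeast0 sum_distrib_left
      intro!: sum.cong)

lemma pos_def_matD:
  assumes "pos_def_mat p A" "i < p" "x i \<noteq> 0"
  shows "(\<Sum>i<p. \<Sum>j<p. A $$ (i, j) * x i * x j) > 0"
proof -
  have "Matrix.vec p x \<noteq> 0\<^sub>v p"
    using assms by (metis index_vec index_zero_vec(1))
  then show ?thesis
    using assms by (auto simp: pos_def_mat_def quadratic_form_sum[symmetric])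
qed

lemma pos_def_matI:
  assumes "A \<in> carrier_mat p p" "transpose_mat A = A"
    and "\<And>x i. i < p \<Longrightarrow> x i \<noteq> 0 \<Longrightarrow> (\<Sum>i<p. \<Sum>j<p. A $$ (i, j) * x i * x j) > 0"
  shows "pos_def_mat p A"
  unfolding pos_def_mat_def
proof (intro conjI ballI impI)
  fix v :: "real vec" assume v: "v \<in> carrier_vec p" "v \<noteq> 0\<^sub>v p"
  then obtain i where i: "i < p" "v $ i \<noteq> 0"
    by (metis carrier_vecD eq_vecI index_zero_vec(1) index_zero_vec(2))
  have "v = Matrix.vec p (\<lambda>i. v $ i)"
    using v by auto
  then show "scalar_prod v (A *\<^sub>v v) > 0"
    using assms(3)[of i "\<lambda>i. v $ i"] i quadratic_form_sum[OF assms(1), of "\<lambda>i. v $ i"] by simp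
qed (use assms in auto)

lemma pos_def_mat_sym:
  assumes "pos_def_mat p A" "i < p" "j < p"
  shows "A $$ (i, j) = A $$ (j, i)"
proof -
  have "transpose_mat A $$ (i, j) = A $$ (j, i)"
    using assms by (intro index_transpose_mat) (auto simp: pos_def_mat_def)
  then show ?thesis
    using assms by (simp add: pos_def_mat_def)
qed

text \<open>The Schur complement of the last diagonal entry.\<close>

definition schur_last :: "nat \<Rightarrow> real mat \<Rightarrow> real mat" where
  "schur_last p A = Matrix.mat p p (\<lambda>(i, j). A $$ (i, j) - A $$ (i, p) * A $$ (p, j) / A $$ (p, p))"

lemma pos_def_last_entry:
  assumes "pos_def_mat (Suc p) A"
  shows "A $$ (p, p) > 0"
  using pos_def_matD[OF assms, of p "\<lambda>i. if i = p then 1 else 0"]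
  by (simp add: if_distrib[of "\<lambda>x. x * _"] if_distrib[of "\<lambda>x. _ * x"] cong: if_cong)

text \<open>
  One step of the elimination: the last variable occurs in a single square, and what is left is the
  quadratic form of the Schur complement.
\<close>

lemma complete_square_last:
  assumes A: "pos_def_mat (Suc p) A"
  shows "(\<Sum>i<Suc p. \<Sum>j<Suc p. A $$ (i, j) * x i * x j)
    = A $$ (p, p) * (x p + (\<Sum>j<p. A $$ (p, j) * x j) / A $$ (p, p))\<^sup>2
      + (\<Sum>i<p. \<Sum>j<p. schur_last p A $$ (i, j) * x i * x j)"
proof -
  define a b where "a = A $$ (p, p)" and "b = (\<Sum>j<p. A $$ (p, j) * x j)"
  have a: "a > 0"
    using pos_def_last_entry[OF A] by (simp add: a_def)
  have col: "(\<Sum>i<p. A $$ (i, p) * x i) = b"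
    unfolding b_def by (intro sum.cong) (auto simp: pos_def_mat_sym[OF A])
  have "b * b = (\<Sum>i<p. A $$ (i, p) * x i) * (\<Sum>j<p. A $$ (p, j) * x j)"
    by (simp only: col b_def[symmetric])
  also have "\<dots> = (\<Sum>i<p. \<Sum>j<p. A $$ (i, p) * A $$ (p, j) * x i * x j)"
    by (simp add: sum_product ac_simps)
  finally have "(\<Sum>i<p. \<Sum>j<p. schur_last p A $$ (i, j) * x i * x j)
      = (\<Sum>i<p. \<Sum>j<p. A $$ (i, j) * x i * x j) - b * b / a"
    by (simp add: schur_last_def a_def sum_subtractf[symmetric] sum_divide_distrib algebra_simps)
  moreover have "(\<Sum>i<Suc p. \<Sum>j<Suc p. A $$ (i, j) * x i * x j)
      = (\<Sum>i<p. \<Sum>j<p. A $$ (i, j) * x i * x j) + 2 * x p * b + a * (x p)\<^sup>2"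
  proof -
    have "(\<Sum>i<p. A $$ (i, p) * x i * x p) = b * x p"
      using col by (simp add: sum_distrib_right[symmetric])
    moreover have "(\<Sum>j<p. A $$ (p, j) * x p * x j) = x p * b"
      by (simp add: b_def sum_distrib_left ac_simps)
    ultimately show ?thesis
      by (simp add: sum.distrib a_def power2_eq_square algebra_simps)
  qed
  moreover have "a * (x p + b / a)\<^sup>2 = a * (x p)\<^sup>2 + 2 * x p * b + b * b / a"
    using a by (simp add: field_simps power2_eq_square)
  ultimately show ?thesis
    unfolding a_def[symmetric] b_def[symmetric] by linarith
qed

lemma pos_def_schur_last:
  assumes A: "pos_def_mat (Suc p) A"
  shows "pos_def_mat p (schur_last p A)"
proof (rule pos_def_matI)
  show "transpose_mat (schur_last p A) = schur_last p A"
    by (rule eq_matI) (auto simp: schur_last_def pos_def_mat_sym[OF A])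
next
  fix x :: "nat \<Rightarrow> real" and i assume i: "i < p" "x i \<noteq> 0"
  define y where "y = x(p := - (\<Sum>j<p. A $$ (p, j) * x j) / A $$ (p, p))"
  have "(\<Sum>i<Suc p. \<Sum>j<Suc p. A $$ (i, j) * y i * y j) > 0"
    using i by (intro pos_def_matD[OF A, of i]) (auto simp: y_def)
  also have "(\<Sum>i<Suc p. \<Sum>j<Suc p. A $$ (i, j) * y i * y j)
      = (\<Sum>i<p. \<Sum>j<p. schur_last p A $$ (i, j) * x i * x j)"
    unfolding complete_square_last[OF A] by (simp add: y_def)
  finally show "(\<Sum>i<p. \<Sum>j<p. schur_last p A $$ (i, j) * x i * x j) > 0" .
qed (auto simp: schur_last_def)

text \<open>
  The matrix is the product of a unipotent block triangular matrix and of a block triangular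
  matrix with the Schur complement on its diagonal.
\<close>

lemma det_schur_last:
  assumes A: "A \<in> carrier_mat (Suc p) (Suc p)" and "A $$ (p, p) \<noteq> 0"
  shows "Determinant.det A = Determinant.det (schur_last p A) * A $$ (p, p)"
proof -
  define U where "U = Matrix.mat p 1 (\<lambda>(i, j). A $$ (i, p) / A $$ (p, p))"
  define R where "R = Matrix.mat 1 p (\<lambda>(i, j). A $$ (p, j))"
  define D where "D = Matrix.mat 1 1 (\<lambda>(i, j). A $$ (p, p))"
  have car: "U \<in> carrier_mat p 1" "R \<in> carrier_mat 1 p" "D \<in> carrier_mat 1 1"
    "schur_last p A \<in> carrier_mat p p"
    by (auto simp: U_def R_def D_def schur_last_def)
  have "A = four_block_mat (1\<^sub>m p) U (0\<^sub>m 1 p) (1\<^sub>m 1) * four_block_mat (schur_last p A) (0\<^sub>m p 1) R D"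
    (is "_ = ?L * ?M")
    by (subst mult_four_block_mat[OF one_carrier_mat car(1) zero_carrier_mat one_carrier_mat
          car(4) zero_carrier_mat car(2,3)])
       (rule eq_matI, use A assms(2) in
        \<open>auto simp: four_block_mat_def U_def R_def D_def schur_last_def scalar_prod_def less_Suc_eq\<close>)
  moreover have "Determinant.det ?L = 1"
    by (subst det_four_block_mat_lower_left_zero[of _ p _ 1]) (use car in auto)
  moreover have "Determinant.det ?M = Determinant.det (schur_last p A) * A $$ (p, p)"
    by (subst det_four_block_mat_upper_right_zero[of _ p _ 1])
       (use car in \<open>auto simp: D_def det_single\<close>)
  moreover have "Determinant.det (?L * ?M) = Determinant.det ?L * Determinant.det ?M"
    by (rule det_mult[of _ "p + 1"]) (use car in auto)
  ultimately show ?thesis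
    by simp
qed

lemma nn_integral_gaussian_line:
  assumes "a > 0"
  shows "(\<integral>\<^sup>+t. ennreal (exp (- (a * (t + c)\<^sup>2) / 2)) \<partial>lborel) = ennreal (sqrt (2 * pi / a))"
proof -
  let ?s = "1 / sqrt a"
  have s: "?s > 0"
    using assms by simp
  have "exp (- (a * (t + c)\<^sup>2) / 2) = sqrt (2 * pi / a) * normal_density (- c) ?s t" for t
    using assms by (simp add: normal_density_def power_divide field_simps real_sqrt_divide)
  then have "(\<integral>\<^sup>+t. ennreal (exp (- (a * (t + c)\<^sup>2) / 2)) \<partial>lborel)
      = (\<integral>\<^sup>+t. ennreal (sqrt (2 * pi / a)) * ennreal (normal_density (- c) ?s t) \<partial>lborel)"
    using assms by (intro nn_integral_cong) (simp add: ennreal_mult)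
  also have "\<dots> = ennreal (sqrt (2 * pi / a)) * (\<integral>\<^sup>+t. ennreal (normal_density (- c) ?s t) \<partial>lborel)"
    by (rule nn_integral_cmult) simp
  also have "(\<integral>\<^sup>+t. ennreal (normal_density (- c) ?s t) \<partial>lborel) = 1"
    using prob_space.emeasure_space_1[OF prob_space_normal_density[OF s, of "- c"]]
    by (simp add: emeasure_density)
  finally show ?thesis
    by simp
qed

text \<open>
  Induction on the dimension.  After completing the square in the last variable, that variable
  integrates to \<open>sqrt (2 * pi / A $$ (p, p))\<close> whatever the others are, and the Schur complement
  takes over; the determinant splits in the same way.  Its sign comes along in the induction and
  gives the invertibility of positive definite matrices.
\<close>

lemma pos_def_gaussian_integral:
  assumes "pos_def_mat p A"
  shows "Determinant.det A > 0 \<and>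
    (\<integral>\<^sup>+x. ennreal (exp (- (\<Sum>i<p. \<Sum>j<p. A $$ (i, j) * x i * x j) / 2)) \<partial>(\<Pi>\<^sub>M j\<in>{..<p}. lborel))
      = ennreal (sqrt ((2 * pi) ^ p / Determinant.det A))"
  using assms
proof (induction p arbitrary: A)
  case 0
  then have "Determinant.det A = 1"
    by (intro det_dim_zero) (auto simp: pos_def_mat_def)
  moreover interpret product_sigma_finite "\<lambda>_::nat. lborel :: real measure" ..
  have "(\<integral>\<^sup>+x. 1 \<partial>(\<Pi>\<^sub>M j\<in>{..<0::nat}. lborel :: real measure)) = 1"
    using product_nn_integral_prod[of "{}" "\<lambda>_ _. 1"] by simp
  ultimately show ?case
    by simp
next
  case (Suc p)
  interpret product_sigma_finite "\<lambda>_::nat. lborel :: real measure" ..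
  let ?B = "schur_last p A" and ?a = "A $$ (p, p)"
  have a: "?a > 0"
    using pos_def_last_entry[OF Suc.prems] .
  have dA: "Determinant.det A = Determinant.det ?B * ?a"
    using Suc.prems a by (intro det_schur_last) (auto simp: pos_def_mat_def)
  note IH = Suc.IH[OF pos_def_schur_last[OF Suc.prems]]
  have "(\<integral>\<^sup>+x. ennreal (exp (- (\<Sum>i<Suc p. \<Sum>j<Suc p. A $$ (i, j) * x i * x j) / 2))
      \<partial>(\<Pi>\<^sub>M j\<in>{..<Suc p}. lborel))
    = (\<integral>\<^sup>+x. ennreal (exp (- (?a * (x p + (\<Sum>j<p. A $$ (p, j) * x j) / ?a)\<^sup>2) / 2)) *
        ennreal (exp (- (\<Sum>i<p. \<Sum>j<p. ?B $$ (i, j) * x i * x j) / 2))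
      \<partial>(\<Pi>\<^sub>M j\<in>insert p {..<p}. lborel))"
    unfolding complete_square_last[OF Suc.prems] lessThan_Suc[symmetric]
    by (intro nn_integral_cong)
       (simp add: ennreal_mult[symmetric] exp_add[symmetric] diff_divide_distrib add_divide_distrib)
  also have "\<dots> = (\<integral>\<^sup>+x. (\<integral>\<^sup>+t. ennreal (exp (- (?a * (t + (\<Sum>j<p. A $$ (p, j) * x j) / ?a)\<^sup>2) / 2)) *
        ennreal (exp (- (\<Sum>i<p. \<Sum>j<p. ?B $$ (i, j) * x i * x j) / 2)) \<partial>lborel)
      \<partial>(\<Pi>\<^sub>M j\<in>{..<p}. lborel))"
    by (subst product_nn_integral_insert) auto
  also have "\<dots> = (\<integral>\<^sup>+x. ennreal (sqrt (2 * pi / ?a)) *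
        ennreal (exp (- (\<Sum>i<p. \<Sum>j<p. ?B $$ (i, j) * x i * x j) / 2)) \<partial>(\<Pi>\<^sub>M j\<in>{..<p}. lborel))"
    by (intro nn_integral_cong, subst nn_integral_multc)
       (simp_all only: nn_integral_gaussian_line[OF a], measurable)
  also have "\<dots> = ennreal (sqrt (2 * pi / ?a)) * ennreal (sqrt ((2 * pi) ^ p / Determinant.det ?B))"
    using IH by (subst nn_integral_cmult) auto
  also have "\<dots> = ennreal (sqrt ((2 * pi) ^ Suc p / Determinant.det A))"
    using a IH by (simp add: ennreal_mult[symmetric] real_sqrt_mult[symmetric] dA mult_ac)
  finally show ?case
    using a IH dA by simp
qed

lemma pos_def_inverse:
  assumes S: "pos_def_mat p S"
  shows "pos_def_mat p (the (mat_inverse S))" "S * the (mat_inverse S) = 1\<^sub>m p"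
    "Determinant.det (the (mat_inverse S)) * Determinant.det S = 1"
proof -
  have car: "S \<in> carrier_mat p p"
    using S by (simp add: pos_def_mat_def)
  have d: "Determinant.det S > 0"
    using pos_def_gaussian_integral[OF S] by simp
  have "S \<in> Units (ring_mat TYPE(real) p ())"
    using det_non_zero_imp_unit[OF car] d by simp
  then obtain B where B: "mat_inverse S = Some B"
    using mat_inverse(1)[OF car, where b = "()"] by (cases "mat_inverse S") auto
  then have inv: "S * B = 1\<^sub>m p" "B * S = 1\<^sub>m p" and B_car: "B \<in> carrier_mat p p"
    using mat_inverse(2)[OF car] by auto
  have sym: "transpose_mat B = B"
  proof -
    have "transpose_mat B * S = 1\<^sub>m p"
      using arg_cong[OF inv(1), of transpose_mat] transpose_mult[OF car B_car] S
      by (simp add: pos_def_mat_def)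
    then have "transpose_mat B * (S * B) = B"
      using car B_car by (simp add: assoc_mult_mat[symmetric, of _ p p _ p _ p])
    then show ?thesis
      using inv B_car by simp
  qed
  have "pos_def_mat p B"
    unfolding pos_def_mat_def
  proof (intro conjI ballI impI B_car sym)
    fix v :: "real vec" assume v: "v \<in> carrier_vec p" "v \<noteq> 0\<^sub>v p"
    define u where "u = B *\<^sub>v v"
    have u: "u \<in> carrier_vec p"
      using B_car v by (simp add: u_def)
    have Su: "S *\<^sub>v u = v"
      using car B_car v inv by (simp add: u_def assoc_mult_mat_vec[symmetric, of S p p B p v])
    have "u \<noteq> 0\<^sub>v p"
    proof
      assume "u = 0\<^sub>v p"
      then have "v = S *\<^sub>v 0\<^sub>v p"
        using Su by simp
      also have "\<dots> = 0\<^sub>v p"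
        using car by (intro eq_vecI) auto
      finally show False using v by simp
    qed
    then have "scalar_prod u (S *\<^sub>v u) > 0"
      using S u by (simp add: pos_def_mat_def)
    then show "scalar_prod v (B *\<^sub>v v) > 0"
      using u v Su by (simp add: u_def[symmetric] comm_scalar_prod[of u p v])
  qed
  moreover have "Determinant.det B * Determinant.det S = 1"
    using det_mult[OF B_car car] inv by simp
  ultimately show "pos_def_mat p (the (mat_inverse S))" "S * the (mat_inverse S) = 1\<^sub>m p"
    "Determinant.det (the (mat_inverse S)) * Determinant.det S = 1"
    using B inv by simp_all
qed

lemma prob_space_gaussian:
  assumes S: "pos_def_mat p S"
  shows "prob_space (gaussian p S)"
proof (rule prob_spaceI)
  let ?B = "the (mat_inverse S)" and ?c = "sqrt ((2 * pi) ^ p * Determinant.det S)"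
  note B = pos_def_inverse[OF S]
  have car: "?B \<in> carrier_mat p p"
    using B(1) by (simp add: pos_def_mat_def)
  have dS: "Determinant.det S > 0"
    using pos_def_gaussian_integral[OF S] by simp
  have dB: "1 / Determinant.det ?B = Determinant.det S"
    using B(3) dS by (subst divide_eq_eq) (auto simp: mult.commute)
  have "emeasure (gaussian p S) (space (gaussian p S))
    = (\<integral>\<^sup>+x. ennreal (exp (- (\<Sum>i<p. \<Sum>j<p. ?B $$ (i, j) * x i * x j) / 2)) * ennreal (1 / ?c)
        \<partial>(\<Pi>\<^sub>M j\<in>{..<p}. lborel))"
    unfolding gaussian_def quadratic_form_sum[OF car]
    by (subst emeasure_density) (auto intro!: nn_integral_cong simp: ennreal_mult[symmetric] dS less_imp_le)
  also have "\<dots> = ennreal (sqrt ((2 * pi) ^ p / Determinant.det ?B)) * ennreal (1 / ?c)"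
    using pos_def_gaussian_integral[OF B(1)] by (subst nn_integral_multc) auto
  also have "(2 * pi) ^ p / Determinant.det ?B = (2 * pi) ^ p * Determinant.det S"
    using dB by (metis mult.right_neutral times_divide_eq_right)
  also have "ennreal ?c * ennreal (1 / ?c) = 1"
    using dS by (simp add: ennreal_mult[symmetric])
  finally show "emeasure (gaussian p S) (space (gaussian p S)) = 1" .
qed

section \<open>Eigenvalues, effective rank and diagonal matrices\<close>

text \<open>
  The number \<open>q\<close> in the proof, the Hermitian form of the symmetric matrix at an eigenvector, equals
  its own conjugate.
\<close>

lemma symmetric_eigenvalue_real:
  fixes A :: "real mat"
  assumes A: "A \<in> carrier_mat p p" and sym: "transpose_mat A = A"
    and a: "eigenvalue (map_mat complex_of_real A) a"
  shows "complex_of_real (Re a) = a"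
proof -
  have sym': "A $$ (i, j) = A $$ (j, i)" if "i < p" "j < p" for i j
  proof -
    have "transpose_mat A $$ (i, j) = A $$ (j, i)"
      using A that by (intro index_transpose_mat) auto
    then show ?thesis using sym by simp
  qed
  obtain v where v: "v \<in> carrier_vec p" "v \<noteq> 0\<^sub>v p" "map_mat complex_of_real A *\<^sub>v v = a \<cdot>\<^sub>v v"
    using a A by (auto simp: eigenvalue_def eigenvector_def)
  have row: "(\<Sum>j<p. of_real (A $$ (i, j)) * v $ j) = a * v $ i" if "i < p" for i
    using arg_cong[OF v(3), of "\<lambda>u. u $ i"] that A v(1)
    by (auto simp: scalar_prod_def lessThan_atLeast0)
  define q where "q = (\<Sum>i<p. \<Sum>j<p. of_real (A $$ (i, j)) * cnj (v $ i) * v $ j)"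
  define N where "N = (\<Sum>i<p. (cmod (v $ i))\<^sup>2)"
  have "q = (\<Sum>i<p. cnj (v $ i) * (a * v $ i))"
    unfolding q_def by (intro sum.cong refl) (simp add: row[symmetric] sum_distrib_left ac_simps)
  also have "\<dots> = a * of_real N"
    unfolding N_def of_real_sum sum_distrib_left
    by (intro sum.cong refl) (simp add: complex_norm_square ac_simps del: of_real_power)
  finally have q: "q = a * of_real N" .
  have "cnj q = (\<Sum>i<p. \<Sum>j<p. of_real (A $$ (i, j)) * v $ i * cnj (v $ j))"
    by (simp add: q_def)
  also have "\<dots> = (\<Sum>j<p. \<Sum>i<p. of_real (A $$ (i, j)) * v $ i * cnj (v $ j))"
    by (rule sum.swap)
  also have "\<dots> = q"
    unfolding q_def by (intro sum.cong refl) (auto simp: sym' ac_simps)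
  finally have "cnj a * of_real N = a * of_real N"
    using q by (metis complex_cnj_complex_of_real complex_cnj_mult)
  moreover have "N \<noteq> 0"
  proof -
    obtain i where "i < p" "v $ i \<noteq> 0"
      using v by (metis carrier_vecD eq_vecI index_zero_vec(1) index_zero_vec(2))
    then have "N > 0"
      unfolding N_def by (intro sum_pos2[of _ i]) auto
    then show ?thesis by simp
  qed
  ultimately have "cnj a = a"
    by simp
  then show ?thesis
    by (metis Reals_cnj_iff of_real_Re)
qed

text \<open>
  The linear factors over the complex numbers are all real, and the embedding of real polynomials
  is injective.
\<close>

lemma symmetric_char_poly_splits:
  assumes A: "(A :: real mat) \<in> carrier_mat p p" and sym: "transpose_mat A = A"
  shows "\<exists>es. char_poly A = (\<Prod>e\<leftarrow>es. [:- e, 1:]) \<and> length es = p"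
proof -
  interpret h: map_poly_inj_idom_hom complex_of_real ..
  let ?A = "map_mat complex_of_real A"
  have cA: "?A \<in> carrier_mat p p"
    using A by simp
  obtain as where as: "char_poly ?A = (\<Prod>a\<leftarrow>as. [:- a, 1:])" "length as = p"
    using char_poly_factorized[OF cA] by auto
  have "complex_of_real (Re a) = a" if "a \<in> set as" for a
  proof (rule symmetric_eigenvalue_real[OF A sym])
    show "eigenvalue ?A a"
      using that unfolding eigenvalue_root_char_poly[OF cA] as(1)
      by (auto simp: poly_prod_list prod_list_zero_iff)
  qed
  then have "map (\<lambda>a. [:- a, 1:]) as = map (map_poly complex_of_real) (map (\<lambda>a. [:- Re a, 1:]) as)"
    by (auto simp: of_real_hom.map_poly_pCons_hom)
  then have "map_poly complex_of_real (char_poly A)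
      = map_poly complex_of_real (\<Prod>a\<leftarrow>as. [:- Re a, 1:])"
    by (simp only: of_real_hom.char_poly_hom[OF A, symmetric] as(1) h.hom_prod_list)
  then have "char_poly A = (\<Prod>a\<leftarrow>as. [:- Re a, 1:])"
    by (simp add: h.eq_iff)
  then show ?thesis
    using as(2) by (intro exI[of _ "map Re as"]) (simp add: o_def)
qed

lemma mat_tr_mult_comm:
  assumes "A \<in> carrier_mat p p" "B \<in> carrier_mat p p"
  shows "mat_tr (A * B) = mat_tr (B * A)"
proof -
  have "mat_tr (A * B) = (\<Sum>i<p. \<Sum>j<p. A $$ (i, j) * B $$ (j, i))"
    using assms by (auto simp: mat_tr_def scalar_prod_def lessThan_atLeast0 intro!: sum.cong)
  also have "\<dots> = (\<Sum>j<p. \<Sum>i<p. B $$ (j, i) * A $$ (i, j))"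
    by (subst sum.swap) (simp add: mult.commute)
  also have "\<dots> = mat_tr (B * A)"
    using assms by (auto simp: mat_tr_def scalar_prod_def lessThan_atLeast0 intro!: sum.cong)
  finally show ?thesis .
qed

text \<open>
  A Schur decomposition is triangular with the eigenvalues on the diagonal, and the trace is
  invariant under similarity.
\<close>

lemma mat_tr_eq_sum_eigenvalues:
  assumes A: "A \<in> carrier_mat p p" and es: "char_poly A = (\<Prod>e\<leftarrow>es. [:- e, 1:])"
  shows "mat_tr A = sum_list es"
proof -
  obtain B P Q where BPQ: "schur_decomposition A es = (B, P, Q)"
    by (cases "schur_decomposition A es") auto
  have sim: "similar_mat_wit A B P Q" and diag: "diag_mat B = es"
    using schur_decomposition[OF A es BPQ] by auto
  note D = similar_mat_witD2[OF A sim]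
  have "mat_tr A = mat_tr (P * (B * Q))"
    using D by (simp add: assoc_mult_mat[of _ p p _ p _ p])
  also have "\<dots> = mat_tr (B * Q * P)"
    using D by (intro mat_tr_mult_comm) auto
  also have "B * Q * P = B"
    using D by (simp add: assoc_mult_mat[of _ p p _ p _ p])
  also have "mat_tr B = sum_list es"
    using diag[symmetric] by (simp add: mat_tr_def diag_mat_def sum_list_distinct_conv_sum_set lessThan_atLeast0)
  finally show ?thesis .
qed

lemma pos_def_eigenvalue_pos:
  assumes "pos_def_mat p A" "eigenvalue A k"
  shows "k > 0"
proof -
  obtain v where v: "v \<in> carrier_vec p" "v \<noteq> 0\<^sub>v p" "A *\<^sub>v v = k \<cdot>\<^sub>v v"
    using assms by (auto simp: eigenvalue_def eigenvector_def pos_def_mat_def)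
  then have "scalar_prod v (A *\<^sub>v v) = k * scalar_prod v v"
    by simp
  moreover have "scalar_prod v (A *\<^sub>v v) > 0"
    using assms v by (auto simp: pos_def_mat_def)
  moreover have "scalar_prod v v \<ge> 0"
    by (auto simp: scalar_prod_def intro!: sum_nonneg)
  ultimately show ?thesis
    by (metis not_less mult_nonpos_nonneg zero_less_mult_iff)
qed

text \<open>
  The trace is a sum of \<open>p\<close> positive eigenvalues, one of which is the largest.  The strict lower
  bound for \<open>p \<ge> 2\<close> keeps the small entries of the diagonal matrix below positive.
\<close>

lemma effective_rank_bounds:
  assumes A: "pos_def_mat p A" and "p \<ge> 1"
  shows "effective_rank A \<le> p" "p = 1 \<Longrightarrow> effective_rank A = 1" "p \<ge> 2 \<Longrightarrow> effective_rank A > 1"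
proof -
  have car: "A \<in> carrier_mat p p" and sym: "transpose_mat A = A"
    using A by (auto simp: pos_def_mat_def)
  obtain es where es: "char_poly A = (\<Prod>e\<leftarrow>es. [:- e, 1:])" "length es = p"
    using symmetric_char_poly_splits[OF car sym] by auto
  have spec: "spectrum A = set es"
    unfolding spectrum_root_char_poly[OF car] es(1) by (auto simp: poly_prod_list prod_list_zero_iff)
  have pos: "e > 0" if "e \<in> set es" for e
    using pos_def_eigenvalue_pos[OF A, of e] that spec by (auto simp: spectrum_def)
  define m where "m = Max (set es)"
  have "set es \<noteq> {}"
    using es(2) assms(2) by auto
  then have m: "m \<in> set es" "\<And>e. e \<in> set es \<Longrightarrow> e \<le> m"
    by (auto simp: m_def)
  have rank: "effective_rank A = sum_list es / m"
    by (simp add: effective_rank_def max_eigenvalue_def spec m_def mat_tr_eq_sum_eigenvalues[OF car es(1)])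
  have "sum_list es \<le> (\<Sum>e\<leftarrow>es. m)"
    using m sum_list_mono[of es "\<lambda>x. x" "\<lambda>_. m"] by simp
  then show "effective_rank A \<le> p"
    using pos[OF m(1)] by (simp add: rank sum_list_triv es(2) divide_le_eq)
  obtain xs ys where split: "es = xs @ m # ys"
    using m(1) by (meson split_list)
  show "effective_rank A = 1" if "p = 1"
    using that split es(2) pos[OF m(1)] by (auto simp: rank)
  show "effective_rank A > 1" if "p \<ge> 2"
  proof -
    have "xs @ ys \<noteq> []"
      using that split es(2) by auto
    then obtain z zs where z: "xs @ ys = z # zs"
      by (cases "xs @ ys") auto
    have "set (z # zs) \<subseteq> set es"
      unfolding z[symmetric] using split by auto
    then have "z > 0" "sum_list zs \<ge> 0"
      using pos by (auto intro!: sum_list_nonneg simp: less_imp_le subset_iff)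
    then have "sum_list (xs @ ys) > 0"
      unfolding z by simp
    then have "sum_list es > m"
      using split by simp
    then show ?thesis
      using pos[OF m(1)] by (simp add: rank)
  qed
qed

lemma pos_def_square:
  assumes S: "pos_def_mat p S"
  shows "pos_def_mat p (S * S)"
  unfolding pos_def_mat_def
proof (intro conjI ballI impI)
  have car: "S \<in> carrier_mat p p" and sym: "transpose_mat S = S"
    using S by (auto simp: pos_def_mat_def)
  show "S * S \<in> carrier_mat p p"
    using car by simp
  show "transpose_mat (S * S) = S * S"
    using transpose_mult[OF car car] sym by simp
  fix v :: "real vec" assume v: "v \<in> carrier_vec p" "v \<noteq> 0\<^sub>v p"
  define u where "u = S *\<^sub>v v"
  have u: "u \<in> carrier_vec p"
    using car v by (simp add: u_def)
  have "scalar_prod v u > 0"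
    using S v by (simp add: pos_def_mat_def u_def)
  then have "u \<noteq> 0\<^sub>v p"
    using v by auto
  then obtain i where i: "i < p" "u $ i \<noteq> 0"
    using u by (metis carrier_vecD eq_vecI index_zero_vec(1) index_zero_vec(2))
  have "scalar_prod v (S * S *\<^sub>v v) = scalar_prod v (S *\<^sub>v u)"
    using car v by (simp add: u_def assoc_mult_mat_vec[of S p p S p v])
  also have "\<dots> = scalar_prod (transpose_mat S *\<^sub>v v) u"
    using transpose_vec_mult_scalar[OF car u v(1)] by simp
  also have "\<dots> = scalar_prod u u"
    by (simp add: sym u_def)
  also have "\<dots> > 0"
    unfolding scalar_prod_def using u i by (intro sum_pos2[of _ i]) (auto simp: zero_less_mult_iff)
  finally show "scalar_prod v (S * S *\<^sub>v v) > 0" .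
qed

lemma diag_entry_sum:
  "(\<Sum>i<p. \<Sum>j<p. mat_diag p d $$ (i, j) * x i * x j) = (\<Sum>i<p. d i * (x i :: real)\<^sup>2)"
proof (intro sum.cong refl)
  fix i assume i: "i \<in> {..<p}"
  have "(\<Sum>j<p. mat_diag p d $$ (i, j) * x i * x j) = (\<Sum>j<p. if i = j then d i * (x i)\<^sup>2 else 0)"
    using i by (intro sum.cong) (auto simp: mat_diag_def power2_eq_square)
  also have "\<dots> = d i * (x i)\<^sup>2"
    using i by simp
  finally show "(\<Sum>j<p. mat_diag p d $$ (i, j) * x i * x j) = d i * (x i)\<^sup>2" .
qed

lemma pos_def_mat_diag:
  assumes "\<And>i. i < p \<Longrightarrow> d i > 0"
  shows "pos_def_mat p (mat_diag p d)"
proof (rule pos_def_matI)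
  show "transpose_mat (mat_diag p d) = mat_diag p d"
    by (rule eq_matI) (auto simp: mat_diag_def)
  fix x :: "nat \<Rightarrow> real" and i assume i: "i < p" "x i \<noteq> 0"
  have "(\<Sum>i<p. d i * (x i)\<^sup>2) > 0"
    using i assms by (intro sum_pos2[of _ i]) (auto simp: less_imp_le)
  then show "(\<Sum>i<p. \<Sum>j<p. mat_diag p d $$ (i, j) * x i * x j) > 0"
    by (simp add: diag_entry_sum)
qed simp

lemma det_mat_diag: "Determinant.det (mat_diag p d) = (\<Prod>i<p. d i :: real)"
proof -
  have "Determinant.det (mat_diag p d) = prod_list (diag_mat (mat_diag p d))"
    by (rule det_upper_triangular[of _ p]) (auto simp: mat_diag_def)
  also have "\<dots> = (\<Prod>i<p. d i)"
    unfolding diag_mat_def by (subst prod.list_conv_set_nth) (auto simp: mat_diag_def lessThan_atLeast0 intro!: prod.cong)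
  finally show ?thesis .
qed

lemma spectrum_mat_diag: "spectrum (mat_diag p d) = d ` {..<p}" for d :: "nat \<Rightarrow> real"
proof -
  have "char_poly (mat_diag p d) = (\<Prod>a\<leftarrow>diag_mat (mat_diag p d). [:- a, 1:])"
    by (rule char_poly_upper_triangular[of _ p]) (auto simp: mat_diag_def)
  then show ?thesis
    unfolding spectrum_root_char_poly[OF mat_diag_dim]
    by (auto simp: poly_prod_list prod_list_zero_iff diag_mat_def mat_diag_def)
qed

lemma mat_inverse_mat_diag:
  fixes d :: "nat \<Rightarrow> real"
  assumes "\<And>i. i < p \<Longrightarrow> d i > 0"
  shows "the (mat_inverse (mat_diag p d)) = mat_diag p (\<lambda>i. 1 / d i)"
proof -
  let ?D = "mat_diag p d" and ?E = "mat_diag p (\<lambda>i. 1 / d i)"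
  let ?B = "the (mat_inverse ?D)"
  have B: "?D * ?B = 1\<^sub>m p" "?B \<in> carrier_mat p p"
    using pos_def_inverse[OF pos_def_mat_diag[of p d]] assms by (auto simp: pos_def_mat_def)
  have ED: "?E * ?D = 1\<^sub>m p"
    unfolding mat_diag_diag by (rule eq_matI) (use assms in \<open>force simp: mat_diag_def\<close>)+
  have "?E = ?E * (?D * ?B)"
    by (simp add: B(1) right_mult_one_mat[OF mat_diag_dim])
  also have "\<dots> = ?E * ?D * ?B"
    by (rule assoc_mult_mat[symmetric, OF mat_diag_dim mat_diag_dim B(2)])
  also have "\<dots> = ?B"
    using B(2) by (simp add: ED del: mat_diag_diag)
  finally show ?thesis
    by simp
qed

text \<open>
  Effective rank and largest eigenvalue can be prescribed with two distinct eigenvalues only,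
  the largest one being simple.  For \<open>p = 1\<close> the number \<open>mu\<close> is not an entry of the matrix; it is
  set to \<open>l\<close> so that it is positive in all cases.
\<close>

lemma spiked_diag_in_cov_class:
  assumes "p \<ge> 1" "l > 0" "cov_class p l r \<noteq> {}"
  defines "mu \<equiv> if p = 1 then l else l * sqrt ((r - 1) / (real p - 1))"
  shows "p = 1 \<Longrightarrow> r = 1" "p \<ge> 2 \<Longrightarrow> r > 1" "mu > 0" "mu \<le> l"
    "mat_diag p (\<lambda>i. if i = 0 then l else mu) \<in> cov_class p l r"
proof -
  obtain S where S: "pos_def_mat p S" "effective_rank (S * S) = r"
    using assms by (auto simp: cov_class_def)
  note rank = effective_rank_bounds[OF pos_def_square[OF S(1)] assms(1), unfolded S(2)]
  show r1: "p = 1 \<Longrightarrow> r = 1" and r2: "p \<ge> 2 \<Longrightarrow> r > 1"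
    using rank by auto
  show mu0: "mu > 0"
    using r2 assms by (auto simp: mu_def)
  show mul: "mu \<le> l"
    using r2 rank(1) assms(1,2) by (auto simp: mu_def mult_le_cancel_left2 divide_le_eq)
  let ?d = "\<lambda>i::nat. if i = 0 then l else mu"
  have Max: "Max (f ` {..<p}) = f 0"
    if "\<And>i. i < p \<Longrightarrow> f i \<le> f 0" for f :: "nat \<Rightarrow> real"
    using that assms(1) by (intro Max_eqI) auto
  have dle: "?d i \<le> l" "?d i > 0" if "i < p" for i
    using that mul mu0 assms(2) by auto
  have sq: "mat_diag p ?d * mat_diag p ?d = mat_diag p (\<lambda>i. ?d i * ?d i)"
    by simp
  have "max_eigenvalue (mat_diag p ?d) = l"
    unfolding max_eigenvalue_def spectrum_mat_diag using dle by (subst Max) auto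
  moreover have "max_eigenvalue (mat_diag p (\<lambda>i. ?d i * ?d i)) = l * l"
    unfolding max_eigenvalue_def spectrum_mat_diag using mul mu0 assms(2)
    by (subst Max) (auto intro!: mult_mono simp: less_imp_le)
  moreover have "mat_tr (mat_diag p (\<lambda>i. ?d i * ?d i)) = r * (l * l)"
  proof -
    obtain q where q: "p = Suc q"
      using assms(1) by (cases p) auto
    have "mat_tr (mat_diag p (\<lambda>i. ?d i * ?d i)) = (\<Sum>i<Suc q. ?d i * ?d i)"
      by (auto simp: mat_tr_def mat_diag_def q intro!: sum.cong)
    also have "\<dots> = l * l + real q * (mu * mu)"
      by (subst sum.lessThan_Suc_shift) simp
    also have "\<dots> = r * (l * l)"
    proof (cases "q = 0")
      case True
      then show ?thesis using r1 q by simp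
    next
      case False
      then have "(r - 1) / real q \<ge> 0"
        using r2 q by simp
      then have "sqrt ((r - 1) / real q) * sqrt ((r - 1) / real q) = (r - 1) / real q"
        by (simp only: real_sqrt_mult_self abs_of_nonneg)
      moreover have "mu * mu = l * l * (sqrt ((r - 1) / real q) * sqrt ((r - 1) / real q))"
        using False by (simp add: mu_def q mult_ac)
      ultimately have "mu * mu = l * l * ((r - 1) / real q)"
        by (simp only:)
      then show ?thesis
        using False by (simp add: field_simps)
    qed
    finally show ?thesis .
  qed
  ultimately show "mat_diag p ?d \<in> cov_class p l r"
    unfolding cov_class_def mem_Collect_eq sq effective_rank_def
    using assms(2) dle by (auto intro!: pos_def_mat_diag)
qed

section \<open>Shifts of product measures and of Gaussian laws\<close>

lemma density_PiM:
  fixes L :: "'i \<Rightarrow> 'a \<Rightarrow> ennreal"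
  assumes I: "finite I" and M: "product_sigma_finite M"
    and L[measurable]: "\<And>i. L i \<in> borel_measurable (M i)"
    and N: "product_sigma_finite (\<lambda>i. density (M i) (L i))"
  shows "density (PiM I M) (\<lambda>x. \<Prod>i\<in>I. L i (x i)) = PiM I (\<lambda>i. density (M i) (L i))"
proof -
  interpret M: product_sigma_finite M by fact
  interpret N: product_sigma_finite "\<lambda>i. density (M i) (L i)" by fact
  have [measurable]: "(\<lambda>x. \<Prod>i\<in>I. L i (x i)) \<in> borel_measurable (PiM I M)"
    by (intro borel_measurable_prod_ennreal) measurable
  show ?thesis
  proof (rule N.PiM_eqI[OF I])
    show "sets (density (PiM I M) (\<lambda>x. \<Prod>i\<in>I. L i (x i))) = sets (PiM I (\<lambda>i. density (M i) (L i)))"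
      by (simp cong: sets_PiM_cong)
    fix A assume "\<And>i. i \<in> I \<Longrightarrow> A i \<in> sets (density (M i) (L i))"
    then have A[measurable]: "A i \<in> sets (M i)" if "i \<in> I" for i
      using that by simp
    have ind: "indicator (Pi\<^sub>E I A) x = (\<Prod>i\<in>I. indicator (A i) (x i) :: ennreal)"
      if "x \<in> space (PiM I M)" for x
      using that I by (auto simp: indicator_def space_PiM PiE_iff intro!: prod_zero[symmetric])
    have "Pi\<^sub>E I A \<in> sets (PiM I M)"
      using I A by (intro sets_PiM_I_finite) auto
    then have "emeasure (density (PiM I M) (\<lambda>x. \<Prod>i\<in>I. L i (x i))) (Pi\<^sub>E I A)
      = (\<integral>\<^sup>+x. (\<Prod>i\<in>I. L i (x i)) * indicator (Pi\<^sub>E I A) x \<partial>PiM I M)"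
      by (subst emeasure_density) auto
    also have "\<dots> = (\<integral>\<^sup>+x. (\<Prod>i\<in>I. L i (x i) * indicator (A i) (x i)) \<partial>PiM I M)"
      by (intro nn_integral_cong) (simp add: ind prod.distrib)
    also have "\<dots> = (\<Prod>i\<in>I. \<integral>\<^sup>+x. L i x * indicator (A i) x \<partial>M i)"
      by (rule M.product_nn_integral_prod[OF I]) measurable
    also have "\<dots> = (\<Prod>i\<in>I. emeasure (density (M i) (L i)) (A i))"
      by (intro prod.cong refl) (simp add: emeasure_density)
    finally show "emeasure (density (PiM I M) (\<lambda>x. \<Prod>i\<in>I. L i (x i))) (Pi\<^sub>E I A)
      = (\<Prod>i\<in>I. emeasure (density (M i) (L i)) (A i))" .
  qed
qed

lemma distr_PiM:
  assumes I: "finite I" and M: "\<And>i. prob_space (M i)"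
    and T[measurable]: "\<And>i. T i \<in> measurable (M i) (N i)"
  shows "distr (PiM I M) (PiM I N) (\<lambda>x. \<lambda>i\<in>I. T i (x i)) = PiM I (\<lambda>i. distr (M i) (N i) (T i))"
proof -
  interpret M: product_prob_space M
    by (rule product_prob_spaceI) (fact M)
  interpret D: product_prob_space "\<lambda>i. distr (M i) (N i) (T i)"
    by (rule product_prob_spaceI) (intro prob_space.prob_space_distr M T)
  have meas: "(\<lambda>x. \<lambda>i\<in>I. T i (x i)) \<in> measurable (PiM I M) (PiM I N)"
    by (intro measurable_restrict) measurable
  show ?thesis
  proof (rule D.PiM_eqI[OF I])
    show "sets (distr (PiM I M) (PiM I N) (\<lambda>x. \<lambda>i\<in>I. T i (x i)))
      = sets (PiM I (\<lambda>i. distr (M i) (N i) (T i)))"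
      by (simp cong: sets_PiM_cong)
    fix A assume "\<And>i. i \<in> I \<Longrightarrow> A i \<in> sets (distr (M i) (N i) (T i))"
    then have A[measurable]: "A i \<in> sets (N i)" if "i \<in> I" for i
      using that by simp
    have "emeasure (distr (PiM I M) (PiM I N) (\<lambda>x. \<lambda>i\<in>I. T i (x i))) (Pi\<^sub>E I A)
      = emeasure (PiM I M) ((\<lambda>x. \<lambda>i\<in>I. T i (x i)) -` Pi\<^sub>E I A \<inter> space (PiM I M))"
      using I A by (intro emeasure_distr meas sets_PiM_I_finite) auto
    also have "(\<lambda>x. \<lambda>i\<in>I. T i (x i)) -` Pi\<^sub>E I A \<inter> space (PiM I M)
      = (\<Pi>\<^sub>E i\<in>I. T i -` A i \<inter> space (M i))"
      by (auto simp: space_PiM PiE_iff restrict_def)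
    also have "emeasure (PiM I M) \<dots> = (\<Prod>i\<in>I. emeasure (M i) (T i -` A i \<inter> space (M i)))"
      using A by (intro M.emeasure_PiM I) measurable
    also have "\<dots> = (\<Prod>i\<in>I. emeasure (distr (M i) (N i) (T i)) (A i))"
      using A by (intro prod.cong refl) (simp add: emeasure_distr)
    finally show "emeasure (distr (PiM I M) (PiM I N) (\<lambda>x. \<lambda>i\<in>I. T i (x i))) (Pi\<^sub>E I A)
      = (\<Prod>i\<in>I. emeasure (distr (M i) (N i) (T i)) (A i))" .
  qed
qed

text \<open>
  Coordinatewise transformations act on densities coordinatewise.  It is applied twice: to the
  coordinates of one observation and to the observations of the sample.
\<close>

lemma distr_PiM_density:
  fixes L :: "'i \<Rightarrow> 'a \<Rightarrow> ennreal"
  assumes I: "finite I" and M: "\<And>i. prob_space (M i)"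
    and T[measurable]: "\<And>i. T i \<in> measurable (M i) (M i)"
    and L[measurable]: "\<And>i. L i \<in> borel_measurable (M i)"
    and eq: "\<And>i. distr (M i) (M i) (T i) = density (M i) (L i)"
  shows "distr (PiM I M) (PiM I M) (\<lambda>x. \<lambda>i\<in>I. T i (x i)) = density (PiM I M) (\<lambda>x. \<Prod>i\<in>I. L i (x i))"
proof -
  interpret M: product_prob_space M
    by (rule product_prob_spaceI) (fact M)
  interpret D: product_prob_space "\<lambda>i. density (M i) (L i)"
    by (rule product_prob_spaceI) (unfold eq[symmetric], intro prob_space.prob_space_distr M T)
  have "density (PiM I M) (\<lambda>x. \<Prod>i\<in>I. L i (x i)) = PiM I (\<lambda>i. density (M i) (L i))"
    by (intro density_PiM I L) unfold_locales
  also have "\<dots> = distr (PiM I M) (PiM I M) (\<lambda>x. \<lambda>i\<in>I. T i (x i))"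
    using distr_PiM[OF I M T] by (simp add: eq)
  finally show ?thesis ..
qed

definition normal_line :: "real \<Rightarrow> real measure" where
  "normal_line v = density lborel (\<lambda>x. ennreal (normal_density 0 (sqrt v) x))"

lemma sets_normal_line[simp, measurable_cong]: "sets (normal_line v) = sets borel"
  by (simp add: normal_line_def)

lemma space_normal_line[simp]: "space (normal_line v) = UNIV"
  by (simp add: normal_line_def)

lemma prob_space_normal_line: "v > 0 \<Longrightarrow> prob_space (normal_line v)"
  unfolding normal_line_def by (rule prob_space_normal_density) simp

text \<open>The density of \<open>N(m, v)\<close> with respect to \<open>N(0, v)\<close>; the argument \<open>v\<close> is the variance.\<close>

definition shift_ratio :: "real \<Rightarrow> real \<Rightarrow> real \<Rightarrow> real" where
  "shift_ratio v m x = exp (m * x / v - m\<^sup>2 / (2 * v))"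

lemma shift_ratio_measurable[measurable]: "shift_ratio v m \<in> borel_measurable borel"
  unfolding shift_ratio_def by measurable

lemma shift_ratio_nonneg[simp]: "shift_ratio v m x \<ge> 0"
  by (simp add: shift_ratio_def)

lemma distr_normal_line_shift:
  assumes v: "v > 0"
  shows "distr (normal_line v) (normal_line v) (\<lambda>x. m + x)
    = density (normal_line v) (\<lambda>x. ennreal (shift_ratio v m x))"
proof (rule measure_eqI)
  fix A assume "A \<in> sets (distr (normal_line v) (normal_line v) (\<lambda>x. m + x))"
  then have [measurable]: "A \<in> sets borel"
    by simp
  have ratio: "normal_density 0 (sqrt v) (y - m) = normal_density 0 (sqrt v) y * shift_ratio v m y" for y
    using v by (simp add: normal_density_def shift_ratio_def exp_add[symmetric] field_simps power2_eq_square)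
  have "emeasure (distr (normal_line v) (normal_line v) (\<lambda>x. m + x)) A
    = (\<integral>\<^sup>+x. indicator A (m + x) \<partial>normal_line v)"
    by (subst nn_integral_indicator[symmetric], simp, subst nn_integral_distr) auto
  also have "\<dots> = (\<integral>\<^sup>+x. ennreal (normal_density 0 (sqrt v) (m + 1 * x - m)) * indicator A (m + 1 * x) \<partial>lborel)"
    by (simp add: normal_line_def nn_integral_density)
  also have "\<dots> = (\<integral>\<^sup>+y. ennreal (normal_density 0 (sqrt v) (y - m)) * indicator A y \<partial>lborel)"
    by (subst nn_integral_real_affine[where c = 1 and t = m
          and f = "\<lambda>y. ennreal (normal_density 0 (sqrt v) (y - m)) * indicator A y"]) auto
  also have "\<dots> = (\<integral>\<^sup>+y. ennreal (shift_ratio v m y) * indicator A y \<partial>normal_line v)"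
    unfolding normal_line_def by (simp add: nn_integral_density ratio ennreal_mult mult.assoc)
  also have "\<dots> = emeasure (density (normal_line v) (\<lambda>x. ennreal (shift_ratio v m x))) A"
    by (simp add: emeasure_density)
  finally show "emeasure (distr (normal_line v) (normal_line v) (\<lambda>x. m + x)) A
    = emeasure (density (normal_line v) (\<lambda>x. ennreal (shift_ratio v m x))) A" .
qed simp

lemma nn_integral_normal_line_square:
  assumes v: "v > 0" and e: "e\<^sup>2 = 1"
  shows "(\<integral>\<^sup>+x. ennreal ((c + e * x)\<^sup>2) \<partial>normal_line v) = ennreal (c\<^sup>2 + v)"
proof -
  let ?d = "normal_density 0 (sqrt v)"
  have s: "sqrt v > 0"
    using v by simp
  have "has_bochner_integral lborel (\<lambda>x. ?d x * x ^ (2 * 0)) 1"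
    using normal_moment_even[OF s, of 0 0] by simp
  then have m0: "has_bochner_integral lborel (\<lambda>x. c\<^sup>2 * ?d x) (c\<^sup>2 * 1)"
    by (intro has_bochner_integral_mult_right) simp
  have m1: "has_bochner_integral lborel (\<lambda>x. 2 * c * e * (?d x * x)) (2 * c * e * 0)"
    using normal_moment_nz_1[OF s, of 0] by (intro has_bochner_integral_mult_right)
  have m2: "has_bochner_integral lborel (\<lambda>x. ?d x * x\<^sup>2) v"
    using normal_moment_even[OF s, of 0 1] v by simp
  have "has_bochner_integral lborel (\<lambda>x. c\<^sup>2 * ?d x + 2 * c * e * (?d x * x) + ?d x * x\<^sup>2)
      (c\<^sup>2 * 1 + 2 * c * e * 0 + v)"
    by (intro has_bochner_integral_add m0 m1 m2)
  also have "(\<lambda>x. c\<^sup>2 * ?d x + 2 * c * e * (?d x * x) + ?d x * x\<^sup>2) = (\<lambda>x. ?d x * (c + e * x)\<^sup>2)"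
  proof
    fix x
    have "(c + e * x)\<^sup>2 = c\<^sup>2 + 2 * c * e * x + x\<^sup>2"
      using e by (simp add: power2_sum power_mult_distrib)
    then show "c\<^sup>2 * ?d x + 2 * c * e * (?d x * x) + ?d x * x\<^sup>2 = ?d x * (c + e * x)\<^sup>2"
      by (simp add: algebra_simps)
  qed
  finally have I: "has_bochner_integral lborel (\<lambda>x. ?d x * (c + e * x)\<^sup>2) (c\<^sup>2 + v)"
    by simp
  have "(\<integral>\<^sup>+x. ennreal ((c + e * x)\<^sup>2) \<partial>normal_line v)
      = (\<integral>\<^sup>+x. ennreal (?d x * (c + e * x)\<^sup>2) \<partial>lborel)"
    by (simp add: normal_line_def nn_integral_density ennreal_mult)
  also have "\<dots> = ennreal (\<integral>x. ?d x * (c + e * x)\<^sup>2 \<partial>lborel)"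
    using I by (intro nn_integral_eq_integral) (auto simp: has_bochner_integral_iff)
  also have "\<dots> = ennreal (c\<^sup>2 + v)"
    using I by (simp add: has_bochner_integral_iff)
  finally show ?thesis .
qed

section \<open>Overlap of two hyperbolic cosines\<close>

lemma cosh_le_exp_abs: "cosh y \<le> exp \<bar>y :: real\<bar>"
proof -
  have "exp y \<le> exp \<bar>y\<bar>" "exp (- y) \<le> exp \<bar>y\<bar>"
    by auto
  then have "exp y + exp (- y) \<le> 2 * exp \<bar>y\<bar>"
    by linarith
  then show ?thesis
    by (simp add: cosh_field_def)
qed

lemma cosh_add_mult_cosh_diff:
  "cosh (x + y) * cosh (x - y) = (cosh x)\<^sup>2 + (sinh (y :: real))\<^sup>2"
proof -
  have "cosh (x + y) * cosh (x - y) = (cosh x)\<^sup>2 * (cosh y)\<^sup>2 - (sinh x)\<^sup>2 * (sinh y)\<^sup>2"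
    by (simp add: cosh_add cosh_diff algebra_simps power2_eq_square)
  also have "\<dots> = (cosh x)\<^sup>2 + (sinh y)\<^sup>2"
    by (simp add: cosh_square_eq algebra_simps)
  finally show ?thesis .
qed

text \<open>
  The exponent is free of \<open>x\<close>: this is the loss of an observer who knows the sign behind the training
  sample and only has to tell apart the two signs of the new observation.
\<close>

lemma cosh_product_ge_abs:
  "(cosh x * cosh y)\<^sup>2 * exp (- 2 * \<bar>y\<bar>) \<le> cosh (x + y) * cosh (x - (y :: real))"
proof -
  have "(cosh y)\<^sup>2 \<le> (exp \<bar>y\<bar>)\<^sup>2"
    by (intro power_mono cosh_le_exp_abs) auto
  then have "(cosh y)\<^sup>2 \<le> exp (2 * \<bar>y\<bar>)"
    by (simp add: exp_double)
  then have "(cosh y)\<^sup>2 * exp (- 2 * \<bar>y\<bar>) \<le> 1"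
    by (simp add: exp_minus divide_simps)
  then have "(cosh x)\<^sup>2 * ((cosh y)\<^sup>2 * exp (- 2 * \<bar>y\<bar>)) \<le> (cosh x)\<^sup>2 * 1"
    by (intro mult_left_mono) auto
  then have "(cosh x * cosh y)\<^sup>2 * exp (- 2 * \<bar>y\<bar>) \<le> (cosh x)\<^sup>2"
    by (simp add: power_mult_distrib mult.assoc)
  also have "\<dots> \<le> cosh (x + y) * cosh (x - y)"
    by (simp add: cosh_add_mult_cosh_diff)
  finally show ?thesis .
qed

lemma tanh_square_le: "(tanh x)\<^sup>2 \<le> (x :: real)\<^sup>2"
proof -
  have *: "tanh x \<le> x" if "x \<ge> 0" for x :: real
  proof -
    have "0 * cosh 0 - sinh 0 \<le> x * cosh x - sinh x"
    proof (rule DERIV_nonneg_imp_nondecreasing[OF that])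
      fix t :: real assume "0 \<le> t" "t \<le> x"
      then have "t * sinh t \<ge> 0" by simp
      moreover have "((\<lambda>t. t * cosh t - sinh t) has_real_derivative t * sinh t) (at t)"
        by (auto intro!: derivative_eq_intros)
      ultimately show "\<exists>y. ((\<lambda>t. t * cosh t - sinh t) has_real_derivative y) (at t) \<and> 0 \<le> y"
        by blast
    qed
    then show ?thesis
      by (simp add: tanh_def divide_le_eq cosh_real_pos)
  qed
  have "\<bar>tanh x\<bar> \<le> \<bar>x\<bar>"
    using *[of "\<bar>x\<bar>"] by (cases "x \<ge> 0") auto
  then show ?thesis
    by (rule abs_le_square_iff[THEN iffD1])
qed

text \<open>
  With \<open>t = tanh x\<close> and \<open>u = tanh y\<close> the left factor has to be compared with \<open>1 - t\<^sup>2 * u\<^sup>2\<close>.  If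
  \<open>t\<^sup>2 * u\<^sup>2 \<le> 1 / 2\<close>, the elementary bound for \<open>ln (1 - t\<^sup>2 * u\<^sup>2)\<close> suffices, as
  \<open>tanh\<close> is dominated by the identity.  Otherwise both arguments are bounded away from zero, so that
  \<open>\<bar>y\<bar> \<le> 3 * x\<^sup>2 * y\<^sup>2\<close>, and the previous lemma applies.
\<close>

lemma cosh_product_ge_square:
  "(cosh x * cosh y)\<^sup>2 * exp (- 6 * (x\<^sup>2 * y\<^sup>2)) \<le> cosh (x + y) * cosh (x - (y :: real))"
proof (cases "(tanh x)\<^sup>2 * (tanh y)\<^sup>2 \<le> 1 / 2")
  case True
  let ?v = "(tanh x)\<^sup>2 * (tanh y)\<^sup>2"
  have v0: "?v \<ge> 0"
    by simp
  have "- 2 * ?v \<le> - ?v - 2 * ?v\<^sup>2"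
    using mult_left_mono[OF True v0] by (simp add: power2_eq_square)
  also have "\<dots> \<le> ln (1 - ?v)"
    by (rule ln_one_minus_pos_lower_bound[OF v0 True])
  finally have "exp (- 2 * ?v) \<le> exp (ln (1 - ?v))"
    by simp
  also have "\<dots> = 1 - ?v"
    using True by (intro exp_ln) linarith
  finally have "exp (- 2 * ?v) \<le> 1 - ?v" .
  moreover have "exp (- 6 * (x\<^sup>2 * y\<^sup>2)) \<le> exp (- 2 * ?v)"
  proof -
    have "?v \<le> x\<^sup>2 * y\<^sup>2"
      by (intro mult_mono tanh_square_le) auto
    moreover have "x\<^sup>2 * y\<^sup>2 \<ge> 0"
      by simp
    ultimately have "?v \<le> 3 * (x\<^sup>2 * y\<^sup>2)"
      by linarith
    then show ?thesis
      by simp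
  qed
  ultimately have "exp (- 6 * (x\<^sup>2 * y\<^sup>2)) \<le> 1 - ?v"
    by linarith
  then have "(cosh x * cosh y)\<^sup>2 * exp (- 6 * (x\<^sup>2 * y\<^sup>2)) \<le> (cosh x * cosh y)\<^sup>2 * (1 - ?v)"
    by (rule mult_left_mono) simp
  also have "\<dots> = (cosh x)\<^sup>2 * (cosh y)\<^sup>2 - (sinh x)\<^sup>2 * (sinh y)\<^sup>2"
    using cosh_real_pos[of x] cosh_real_pos[of y]
    by (simp add: tanh_def power_mult_distrib power_divide field_simps)
  also have "\<dots> = cosh (x + y) * cosh (x - y)"
    by (subst cosh_add_mult_cosh_diff) (simp add: cosh_square_eq algebra_simps)
  finally show ?thesis .
next
  case False
  have le1: "(tanh z)\<^sup>2 \<le> 1" for z :: real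
    using tanh_real_bounds[of z] by (auto simp: abs_square_le_1 abs_le_iff)
  have "(tanh x)\<^sup>2 * (tanh y)\<^sup>2 \<le> (tanh x)\<^sup>2 * 1" "(tanh x)\<^sup>2 * (tanh y)\<^sup>2 \<le> 1 * (tanh y)\<^sup>2"
    by (intro mult_left_mono mult_right_mono le1; simp)+
  then have x: "x\<^sup>2 > 1 / 2" and y: "y\<^sup>2 > 1 / 2"
    using False tanh_square_le[of x] tanh_square_le[of y] by linarith+
  have "\<bar>y\<bar> \<ge> 7 / 10"
  proof (rule ccontr)
    assume "\<not> \<bar>y\<bar> \<ge> 7 / 10"
    then have "\<bar>y\<bar>\<^sup>2 \<le> (7 / 10)\<^sup>2"
      by (intro power_mono) auto
    then show False
      using y by (simp add: power2_eq_square)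
  qed
  then have "1 \<le> 3 * (1 / 2 * \<bar>y\<bar>)"
    by simp
  also have "\<dots> \<le> 3 * (x\<^sup>2 * \<bar>y\<bar>)"
    using x by (intro mult_left_mono mult_right_mono) auto
  finally have "1 * \<bar>y\<bar> \<le> 3 * (x\<^sup>2 * \<bar>y\<bar>) * \<bar>y\<bar>"
    by (intro mult_right_mono) auto
  then have "\<bar>y\<bar> \<le> 3 * (x\<^sup>2 * y\<^sup>2)"
    by (simp add: power2_eq_square mult_ac)
  then have "(cosh x * cosh y)\<^sup>2 * exp (- 6 * (x\<^sup>2 * y\<^sup>2)) \<le> (cosh x * cosh y)\<^sup>2 * exp (- 2 * \<bar>y\<bar>)"
    by (intro mult_left_mono) auto
  also note cosh_product_ge_abs[of x y]
  finally show ?thesis .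
qed

text \<open>
  Put \<open>A = exp (- m)\<close>.  The inequality of arithmetic and geometric means gives
  \<open>A * sqrt (g1 * g2) \<le> min g1 g2 + A\<^sup>2 / 4 * max g1 g2\<close>, and the tangent of the
  exponential function at \<open>m\<close> gives \<open>exp (- X) \<ge> A * (1 + m - X)\<close>.  When \<open>g0\<close>, \<open>g1\<close>, \<open>g2\<close> are
  probability densities and \<open>X\<close> has mean at most \<open>m\<close> under \<open>g0\<close>, integration leaves \<open>A\<^sup>2 / 2\<close> as a
  lower bound of the integral of the minimum.
\<close>

lemma min_ge_affine_overlap:
  fixes g1 g2 g0 X m :: real
  assumes "g1 \<ge> 0" "g2 \<ge> 0" "g0 \<ge> 0" and ov: "g0\<^sup>2 * exp (- 2 * X) \<le> g1 * g2"
  shows "exp (- 2 * m) * (1 + m) * g0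
    \<le> min g1 g2 + exp (- 2 * m) * (X * g0) + exp (- 2 * m) / 4 * (g1 + g2)"
proof -
  define A where "A = exp (- m)"
  have A: "A > 0" "exp (- 2 * m) = A * A"
    by (auto simp: A_def exp_add[symmetric])
  let ?s = "min g1 g2" and ?t = "max g1 g2"
  have st: "?s \<ge> 0" "?t \<ge> 0" "?s * ?t = g1 * g2" "?t \<le> g1 + g2"
    using assms(1,2) by (auto simp: min_def max_def)
  have "(g0 * exp (- X))\<^sup>2 \<le> (sqrt ?s * sqrt ?t)\<^sup>2"
    using ov st by (simp add: power_mult_distrib exp_double[symmetric])
  then have "g0 * exp (- X) \<le> sqrt ?s * sqrt ?t"
    by (rule power2_le_imp_le) (use st in auto)
  then have "A * (g0 * exp (- X)) \<le> A * (sqrt ?s * sqrt ?t)"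
    using A by simp
  also have "\<dots> \<le> ?s + A * A / 4 * ?t"
  proof -
    have "0 \<le> (sqrt ?s - A / 2 * sqrt ?t)\<^sup>2"
      by simp
    also have "\<dots> = (sqrt ?s)\<^sup>2 + A * A / 4 * (sqrt ?t)\<^sup>2 - A * (sqrt ?s * sqrt ?t)"
      by (simp add: power2_eq_square algebra_simps)
    finally show ?thesis
      using st(1,2) by simp
  qed
  also have "\<dots> \<le> ?s + A * A / 4 * (g1 + g2)"
    using A st by simp
  finally have 1: "A * (g0 * exp (- X)) \<le> ?s + A * A / 4 * (g1 + g2)" .
  have "1 + (m - X) \<le> exp (m - X)"
    by (rule exp_ge_add_one_self)
  then have "A * (1 + (m - X)) \<le> A * exp (m - X)"
    using A by simp
  also have "\<dots> = exp (- X)"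
    by (simp add: A_def exp_add[symmetric])
  finally have "A * (g0 * (A * (1 + (m - X)))) \<le> A * (g0 * exp (- X))"
    using A assms(3) by (intro mult_left_mono) auto
  then show ?thesis
    using 1 unfolding A(2) by (simp add: algebra_simps)
qed

section \<open>Noise with independent coordinates\<close>

text \<open>For a diagonal covariance matrix the coordinates of the noise are independent.\<close>

lemma gaussian_mat_diag:
  assumes d: "\<And>j. d j > 0"
  shows "gaussian p (mat_diag p d) = (\<Pi>\<^sub>M j\<in>{..<p}. normal_line (d j))"
proof -
  let ?L = "\<lambda>j x. ennreal (normal_density 0 (sqrt (d j)) x)"
  have dens: "exp (- scalar_prod (Matrix.vec p x) (the (mat_inverse (mat_diag p d)) *\<^sub>v Matrix.vec p x) / 2)
      / sqrt ((2 * pi) ^ p * Determinant.det (mat_diag p d))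
    = (\<Prod>j<p. normal_density 0 (sqrt (d j)) (x j))" for x
  proof -
    have "(\<Prod>j<p. normal_density 0 (sqrt (d j)) (x j))
      = (\<Prod>j<p. exp (- (x j)\<^sup>2 / (2 * d j))) / (\<Prod>j<p. sqrt (2 * pi * d j))"
      using d by (simp add: normal_density_def prod_dividef less_imp_le)
    also have "(\<Prod>j<p. exp (- (x j)\<^sup>2 / (2 * d j))) = exp (\<Sum>j<p. - (x j)\<^sup>2 / (2 * d j))"
      by (simp add: exp_sum)
    also have "(\<Sum>j<p. - (x j)\<^sup>2 / (2 * d j)) = - (\<Sum>j<p. 1 / d j * (x j)\<^sup>2) / 2"
      by (simp add: sum_negf sum_divide_distrib mult.commute)
    also have "(\<Prod>j<p. sqrt (2 * pi * d j)) = sqrt (\<Prod>j<p. 2 * pi * d j)"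
      by (induction p) (auto simp: real_sqrt_mult)
    also have "(\<Prod>j<p. 2 * pi * d j) = (2 * pi) ^ p * Determinant.det (mat_diag p d)"
      by (simp add: det_mat_diag prod.distrib power_mult_distrib)
    finally show ?thesis
      using d by (simp add: mat_inverse_mat_diag quadratic_form_sum[OF mat_diag_dim] diag_entry_sum)
  qed
  have "product_sigma_finite (\<lambda>_::nat. lborel :: real measure)" ..
  moreover have "product_sigma_finite (\<lambda>j. density lborel (?L j))"
  proof -
    interpret product_prob_space "\<lambda>j. normal_line (d j)"
      by (rule product_prob_spaceI) (intro prob_space_normal_line d)
    show ?thesis
      unfolding normal_line_def[symmetric] ..
  qed
  ultimately have "density (\<Pi>\<^sub>M j\<in>{..<p}. lborel) (\<lambda>x. \<Prod>j<p. ?L j (x j))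
    = (\<Pi>\<^sub>M j\<in>{..<p}. normal_line (d j))"
    unfolding normal_line_def by (intro density_PiM) auto
  then show ?thesis
    unfolding gaussian_def dens by (simp add: prod_ennreal)
qed

lemma sets_gaussian[measurable_cong]: "sets (gaussian p S) = sets (obs_space p)"
  unfolding gaussian_def obs_space_def by (simp cong: sets_PiM_cong)

lemma observe_measurable[measurable]: "observe p \<theta> e \<in> measurable (obs_space p) (obs_space p)"
  unfolding observe_def obs_space_def by measurable

text \<open>
  The variances are indexed by all natural numbers, and positive for all of them, so that the
  coordinates form a family of probability spaces without side conditions on the index.
\<close>

locale diag_noise =
  fixes n p :: nat and v :: "nat \<Rightarrow> real"
  assumes v_pos: "v j > 0"
begin

definition noise :: "(nat \<Rightarrow> real) measure" where
  "noise = (\<Pi>\<^sub>M j\<in>{..<p}. normal_line (v j))"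

definition noises :: "(nat \<Rightarrow> nat \<Rightarrow> real) measure" where
  "noises = (\<Pi>\<^sub>M i\<in>{..<n}. noise)"

text \<open>
  The likelihood ratio, with respect to pure noise, of one observation with center \<open>\<theta>\<close> and label
  \<open>e\<close>; \<open>liks\<close> is the one of the training sample.
\<close>

definition lik :: "(nat \<Rightarrow> real) \<Rightarrow> real \<Rightarrow> (nat \<Rightarrow> real) \<Rightarrow> real" where
  "lik \<theta> e w = (\<Prod>j<p. shift_ratio (v j) (\<theta> j * e) (w j))"

definition liks :: "(nat \<Rightarrow> real) \<Rightarrow> (nat \<Rightarrow> real) \<Rightarrow> (nat \<Rightarrow> nat \<Rightarrow> real) \<Rightarrow> real" where
  "liks \<theta> \<eta> W = (\<Prod>i<n. lik \<theta> (\<eta> i) (W i))"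

definition observes :: "(nat \<Rightarrow> real) \<Rightarrow> (nat \<Rightarrow> real) \<Rightarrow> (nat \<Rightarrow> nat \<Rightarrow> real) \<Rightarrow> (nat \<Rightarrow> nat \<Rightarrow> real)" where
  "observes \<theta> \<eta> W = (\<lambda>i\<in>{..<n}. observe p \<theta> (\<eta> i) (W i))"

lemma sets_noise[measurable_cong]: "sets noise = sets (obs_space p)"
  unfolding noise_def obs_space_def by (simp cong: sets_PiM_cong)

sublocale noise: prob_space noise
  unfolding noise_def by (intro prob_space_PiM prob_space_normal_line v_pos)

sublocale rows: product_prob_space "\<lambda>_::nat. noise"
  by (rule product_prob_spaceI) (rule noise.prob_space_axioms)

sublocale noises: prob_space noises
  unfolding noises_def by (intro prob_space_PiM noise.prob_space_axioms)

sublocale noise_pair: pair_prob_space noises noise ..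

lemma coord_measurable: "j < p \<Longrightarrow> (\<lambda>w. w j) \<in> borel_measurable noise"
  unfolding noise_def by measurable

lemma row_measurable: "i < n \<Longrightarrow> (\<lambda>W. W i) \<in> measurable noises noise"
  unfolding noises_def by measurable

lemma lik_measurable[measurable]: "lik \<theta> e \<in> borel_measurable noise"
  unfolding lik_def
proof (rule borel_measurable_prod)
  fix j assume "j \<in> {..<p}"
  then show "(\<lambda>w. shift_ratio (v j) (\<theta> j * e) (w j)) \<in> borel_measurable noise"
    by (intro measurable_compose[OF coord_measurable shift_ratio_measurable]) simp
qed

lemma liks_measurable[measurable]: "liks \<theta> \<eta> \<in> borel_measurable noises"
  unfolding liks_def
proof (rule borel_measurable_prod)
  fix i assume "i \<in> {..<n}"
  then show "(\<lambda>W. lik \<theta> (\<eta> i) (W i)) \<in> borel_measurable noises"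
    by (intro measurable_compose[OF row_measurable lik_measurable]) simp
qed

lemma lik_nonneg[simp]: "lik \<theta> e w \<ge> 0" and liks_nonneg[simp]: "liks \<theta> \<eta> W \<ge> 0"
  by (auto simp: lik_def liks_def intro!: prod_nonneg)

lemma observe_comp_measurable[measurable (raw)]:
  "f \<in> measurable M noise \<Longrightarrow> (\<lambda>x. observe p \<theta> e (f x)) \<in> measurable M noise"
  using measurable_compose[of f M noise "observe p \<theta> e" noise] observe_measurable[of p \<theta> e]
  by (simp cong: measurable_cong_sets add: sets_noise)

lemma observes_measurable: "observes \<theta> \<eta> \<in> measurable noises noises"
  unfolding observes_def[abs_def] noises_def
  by (intro measurable_restrict observe_comp_measurable measurable_component_singleton)

lemma observes_comp_measurable[measurable (raw)]:
  "f \<in> measurable M noises \<Longrightarrow> (\<lambda>x. observes \<theta> \<eta> (f x)) \<in> measurable M noises"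
  by (rule measurable_compose[OF _ observes_measurable])

lemma distr_observe: "distr noise noise (observe p \<theta> e) = density noise (\<lambda>w. ennreal (lik \<theta> e w))"
proof -
  have "distr noise noise (\<lambda>w. \<lambda>j\<in>{..<p}. \<theta> j * e + w j)
      = density noise (\<lambda>w. \<Prod>j<p. ennreal (shift_ratio (v j) (\<theta> j * e) (w j)))"
    unfolding noise_def
    by (intro distr_PiM_density)
      (auto simp: prob_space_normal_line v_pos distr_normal_line_shift cong: measurable_cong_sets)
  then show ?thesis
    by (simp add: observe_def[abs_def] lik_def prod_ennreal)
qed

lemma distr_observes: "distr noises noises (observes \<theta> \<eta>) = density noises (\<lambda>W. ennreal (liks \<theta> \<eta> W))"
proof -
  have "distr noises noises (\<lambda>W. \<lambda>i\<in>{..<n}. observe p \<theta> (\<eta> i) (W i))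
      = density noises (\<lambda>W. \<Prod>i<n. ennreal (lik \<theta> (\<eta> i) (W i)))"
    unfolding noises_def by (intro distr_PiM_density) (auto simp: noise.prob_space_axioms distr_observe)
  then show ?thesis
    by (simp add: observes_def[abs_def] liks_def prod_ennreal)
qed

text \<open>
  The Cameron-Martin formula for the sample and a new observation, whose centers may differ: the
  reference law of the testing argument has independent centers.
\<close>

lemma nn_integral_shift:
  assumes F[measurable]: "F \<in> borel_measurable (noises \<Otimes>\<^sub>M noise)"
  shows "(\<integral>\<^sup>+z. F (observes \<theta> \<eta> (fst z), observe p \<theta>' e (snd z)) \<partial>(noises \<Otimes>\<^sub>M noise))
    = (\<integral>\<^sup>+z. F z * ennreal (liks \<theta> \<eta> (fst z) * lik \<theta>' e (snd z)) \<partial>(noises \<Otimes>\<^sub>M noise))"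
proof -
  have obs: "observe p \<theta>' e \<in> measurable noise noise"
    using observe_comp_measurable[where f = "\<lambda>w. w" and M = noise] by simp
  have inner: "(\<integral>\<^sup>+w. F (W, observe p \<theta>' e w) \<partial>noise) = (\<integral>\<^sup>+w. F (W, w) * ennreal (lik \<theta>' e w) \<partial>noise)"
    if W[measurable]: "W \<in> space noises" for W
  proof -
    have "(\<integral>\<^sup>+w. F (W, observe p \<theta>' e w) \<partial>noise) = (\<integral>\<^sup>+w. F (W, w) \<partial>distr noise noise (observe p \<theta>' e))"
      by (subst nn_integral_distr[OF obs]) auto
    also have "\<dots> = (\<integral>\<^sup>+w. F (W, w) * ennreal (lik \<theta>' e w) \<partial>noise)"
      unfolding distr_observe by (subst nn_integral_density) (auto simp: mult.commute)
    finally show ?thesis .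
  qed
  define \<Phi> where "\<Phi> = (\<lambda>W. \<integral>\<^sup>+w. F (W, w) * ennreal (lik \<theta>' e w) \<partial>noise)"
  have [measurable]: "\<Phi> \<in> borel_measurable noises"
    unfolding \<Phi>_def by measurable
  have "(\<integral>\<^sup>+z. F (observes \<theta> \<eta> (fst z), observe p \<theta>' e (snd z)) \<partial>(noises \<Otimes>\<^sub>M noise))
    = (\<integral>\<^sup>+W. (\<integral>\<^sup>+w. F (observes \<theta> \<eta> W, observe p \<theta>' e w) \<partial>noise) \<partial>noises)"
    by (subst noise.nn_integral_fst[symmetric]) auto
  also have "\<dots> = (\<integral>\<^sup>+W. \<Phi> (observes \<theta> \<eta> W) \<partial>noises)"
    unfolding \<Phi>_def by (intro nn_integral_cong inner measurable_space[OF observes_measurable])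
  also have "\<dots> = (\<integral>\<^sup>+W. \<Phi> W \<partial>distr noises noises (observes \<theta> \<eta>))"
    by (subst nn_integral_distr[OF observes_measurable]) auto
  also have "\<dots> = (\<integral>\<^sup>+W. \<Phi> W * ennreal (liks \<theta> \<eta> W) \<partial>noises)"
    unfolding distr_observes by (subst nn_integral_density) (auto simp: mult.commute)
  also have "\<dots> = (\<integral>\<^sup>+W. (\<integral>\<^sup>+w. F (W, w) * ennreal (liks \<theta> \<eta> W * lik \<theta>' e w) \<partial>noise) \<partial>noises)"
  proof (intro nn_integral_cong)
    fix W assume [measurable]: "W \<in> space noises"
    have "\<Phi> W * ennreal (liks \<theta> \<eta> W)
        = (\<integral>\<^sup>+w. F (W, w) * ennreal (lik \<theta>' e w) * ennreal (liks \<theta> \<eta> W) \<partial>noise)"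
      unfolding \<Phi>_def by (rule nn_integral_multc[symmetric]) measurable
    then show "\<Phi> W * ennreal (liks \<theta> \<eta> W)
        = (\<integral>\<^sup>+w. F (W, w) * ennreal (liks \<theta> \<eta> W * lik \<theta>' e w) \<partial>noise)"
      by (simp add: ennreal_mult mult_ac)
  qed
  also have "\<dots> = (\<integral>\<^sup>+z. F z * ennreal (liks \<theta> \<eta> (fst z) * lik \<theta>' e (snd z)) \<partial>(noises \<Otimes>\<^sub>M noise))"
    by (subst noise.nn_integral_fst[symmetric]) auto
  finally show ?thesis .
qed

lemma nn_integral_coord_square:
  assumes "j < p" "e\<^sup>2 = 1"
  shows "(\<integral>\<^sup>+w. ennreal ((c + e * w j)\<^sup>2) \<partial>noise) = ennreal (c\<^sup>2 + v j)"
proof -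
  have "(\<integral>\<^sup>+w. ennreal ((c + e * w j)\<^sup>2) \<partial>noise)
    = (\<integral>\<^sup>+x. ennreal ((c + e * x)\<^sup>2) \<partial>distr noise (normal_line (v j)) (\<lambda>w. w j))"
  proof (rule nn_integral_distr[symmetric])
    show "(\<lambda>w. w j) \<in> measurable noise (normal_line (v j))"
      unfolding noise_def using assms(1) by (intro measurable_component_singleton) simp
    show "(\<lambda>x. ennreal ((c + e * x)\<^sup>2)) \<in> borel_measurable (distr noise (normal_line (v j)) (\<lambda>w. w j))"
      by measurable
  qed
  also have "distr noise (normal_line (v j)) (\<lambda>w. w j) = normal_line (v j)"
    unfolding noise_def using assms(1) by (intro distr_PiM_component prob_space_normal_line v_pos) auto
  finally show ?thesis
    using nn_integral_normal_line_square[OF v_pos assms(2)] by simp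
qed

lemma row_sum_measurable:
  assumes "j < p"
  shows "(\<lambda>W. \<Sum>i\<in>I. \<eta> i * W i j) \<in> borel_measurable (\<Pi>\<^sub>M i\<in>I. noise)"
proof (rule borel_measurable_sum)
  fix i assume "i \<in> I"
  then have "(\<lambda>W. W i j) \<in> borel_measurable (\<Pi>\<^sub>M i\<in>I. noise)"
    by (rule measurable_compose[OF measurable_component_singleton[of i I "\<lambda>_. noise"] coord_measurable[OF assms]])
  then show "(\<lambda>W. \<eta> i * W i j) \<in> borel_measurable (\<Pi>\<^sub>M i\<in>I. noise)"
    by (intro borel_measurable_times) auto
qed

text \<open>
  The second moment grows linearly in the number of rows because the noise of distinct rows is
  independent and centered.  Integrating out one row at a time, with the constant \<open>c\<close> absorbing the
  other rows, avoids the expansion of the square.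
\<close>

lemma nn_integral_row_sum_square:
  assumes j: "j < p" and I: "finite I" and \<eta>: "\<And>i. i \<in> I \<Longrightarrow> (\<eta> i)\<^sup>2 = 1"
  shows "(\<integral>\<^sup>+W. ennreal ((c + (\<Sum>i\<in>I. \<eta> i * W i j))\<^sup>2) \<partial>(\<Pi>\<^sub>M i\<in>I. noise)) = ennreal (c\<^sup>2 + card I * v j)"
  using I \<eta>
proof (induction I)
  case empty
  interpret E: prob_space "\<Pi>\<^sub>M i\<in>({} :: nat set). noise"
    by (intro prob_space_PiM noise.prob_space_axioms)
  show ?case
    by (simp add: E.emeasure_space_1)
next
  case (insert k I)
  have meas: "(\<lambda>W. ennreal ((c + (\<Sum>i\<in>insert k I. \<eta> i * W i j))\<^sup>2)) \<in> borel_measurable (\<Pi>\<^sub>M i\<in>insert k I. noise)"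
    by (rule measurable_compose[OF row_sum_measurable[OF j], where g = "\<lambda>t. ennreal ((c + t)\<^sup>2)"]) measurable
  have "(\<integral>\<^sup>+W. ennreal ((c + (\<Sum>i\<in>insert k I. \<eta> i * W i j))\<^sup>2) \<partial>(\<Pi>\<^sub>M i\<in>insert k I. noise))
    = (\<integral>\<^sup>+W. (\<integral>\<^sup>+w. ennreal ((c + (\<Sum>i\<in>insert k I. \<eta> i * (W(k := w)) i j))\<^sup>2) \<partial>noise) \<partial>(\<Pi>\<^sub>M i\<in>I. noise))"
    by (rule rows.product_nn_integral_insert[OF insert.hyps(1,2) meas])
  also have "\<dots> = (\<integral>\<^sup>+W. (\<integral>\<^sup>+w. ennreal ((c + (\<Sum>i\<in>I. \<eta> i * W i j) + \<eta> k * w j)\<^sup>2) \<partial>noise) \<partial>(\<Pi>\<^sub>M i\<in>I. noise))"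
  proof (intro nn_integral_cong)
    fix W w
    have "(\<Sum>i\<in>I. \<eta> i * (W(k := w)) i j) = (\<Sum>i\<in>I. \<eta> i * W i j)"
      using insert.hyps by (intro sum.cong) auto
    then show "ennreal ((c + (\<Sum>i\<in>insert k I. \<eta> i * (W(k := w)) i j))\<^sup>2)
      = ennreal ((c + (\<Sum>i\<in>I. \<eta> i * W i j) + \<eta> k * w j)\<^sup>2)"
      using insert.hyps by (simp add: add_ac)
  qed
  also have "\<dots> = (\<integral>\<^sup>+W. ennreal ((c + (\<Sum>i\<in>I. \<eta> i * W i j))\<^sup>2) + ennreal (v j) \<partial>(\<Pi>\<^sub>M i\<in>I. noise))"
    using insert.prems by (intro nn_integral_cong)
      (simp add: nn_integral_coord_square[OF j] ennreal_plus v_pos less_imp_le)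
  also have "\<dots> = (\<integral>\<^sup>+W. ennreal ((c + (\<Sum>i\<in>I. \<eta> i * W i j))\<^sup>2) \<partial>(\<Pi>\<^sub>M i\<in>I. noise)) + ennreal (v j)"
  proof -
    interpret E: prob_space "\<Pi>\<^sub>M i\<in>I. noise"
      by (intro prob_space_PiM noise.prob_space_axioms)
    have "(\<lambda>W. ennreal ((c + (\<Sum>i\<in>I. \<eta> i * W i j))\<^sup>2)) \<in> borel_measurable (\<Pi>\<^sub>M i\<in>I. noise)"
      by (rule measurable_compose[OF row_sum_measurable[OF j], where g = "\<lambda>t. ennreal ((c + t)\<^sup>2)"]) measurable
    then show ?thesis
      by (subst nn_integral_add) (auto simp: E.emeasure_space_1)
  qed
  also have "\<dots> = ennreal (c\<^sup>2 + card (insert k I) * v j)"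
  proof -
    have "ennreal (c\<^sup>2 + card I * v j) + ennreal (v j) = ennreal (c\<^sup>2 + card I * v j + v j)"
      using v_pos[of j] by (intro ennreal_plus[symmetric]) auto
    moreover have "c\<^sup>2 + card I * v j + v j = c\<^sup>2 + card (insert k I) * v j"
      using insert.hyps by (simp add: algebra_simps)
    ultimately show ?thesis
      using insert by simp
  qed
  finally show ?case .
qed

end

section \<open>Random signs and the mixture testing problem\<close>

context diag_noise
begin

definition signs :: "(nat \<Rightarrow> real) set" where
  "signs = {..<p} \<rightarrow>\<^sub>E {-1, 1}"

lemma finite_signs: "finite signs" and card_signs: "card signs = 2 ^ p"
proof -
  have "card {-1, 1 :: real} = 2"
    by simp
  then show "finite signs" "card signs = 2 ^ p"
    by (auto simp only: signs_def card_PiE finite_lessThan prod_constant card_lessThan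
        finite.intros intro!: finite_PiE)
qed

lemma sign_square:
  assumes "s \<in> signs" "j < p"
  shows "(s j)\<^sup>2 = 1"
proof -
  have "s j \<in> {-1, 1}"
    using assms PiE_mem[of s "{..<p}" "\<lambda>_. {-1, 1}" j] by (simp add: signs_def)
  then show ?thesis
    by auto
qed

lemma sum_signs_exp: "(\<Sum>s\<in>signs. \<Prod>j<p. exp (s j * z j)) = 2 ^ p * (\<Prod>j<p. cosh (z j :: real))"
proof -
  have "(\<Sum>s\<in>signs. \<Prod>j<p. exp (s j * z j)) = (\<Prod>j<p. \<Sum>t\<in>{-1, 1 :: real}. exp (t * z j))"
    unfolding signs_def by (rule prod_sum_PiE[symmetric]) auto
  also have "\<dots> = (\<Prod>j<p. 2 * cosh (z j))"
    by (intro prod.cong) (auto simp: cosh_field_def)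
  finally show ?thesis
    by (simp add: prod.distrib)
qed

definition center :: "(nat \<Rightarrow> real) \<Rightarrow> (nat \<Rightarrow> real) \<Rightarrow> nat \<Rightarrow> real" where
  "center a s = (\<lambda>j\<in>{..<p}. a j * s j)"

text \<open>
  The likelihood ratios depend on the sample and on the new observation only through
  \<open>train_stat\<close> and \<open>new_stat\<close>, which appear next to the sign in the exponent.
\<close>

definition train_stat :: "(nat \<Rightarrow> real) \<Rightarrow> (nat \<Rightarrow> real) \<Rightarrow> (nat \<Rightarrow> nat \<Rightarrow> real) \<Rightarrow> nat \<Rightarrow> real" where
  "train_stat a \<eta> W j = a j / v j * (\<Sum>i<n. \<eta> i * W i j)"

definition new_stat :: "(nat \<Rightarrow> real) \<Rightarrow> (nat \<Rightarrow> real) \<Rightarrow> nat \<Rightarrow> real" where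
  "new_stat a w j = a j / v j * w j"

lemma train_stat_measurable[measurable]:
  "j < p \<Longrightarrow> (\<lambda>W. train_stat a \<eta> W j) \<in> borel_measurable noises"
  unfolding train_stat_def noises_def
  by (intro borel_measurable_times borel_measurable_const row_sum_measurable)

lemma new_stat_measurable[measurable]: "j < p \<Longrightarrow> (\<lambda>w. new_stat a w j) \<in> borel_measurable noise"
  unfolding new_stat_def
  by (intro borel_measurable_times borel_measurable_const coord_measurable)

definition row_const :: "(nat \<Rightarrow> real) \<Rightarrow> real" where
  "row_const a = (\<Prod>j<p. exp (- (a j)\<^sup>2 / (2 * v j)))"

lemma lik_center:
  assumes "s \<in> signs" "e\<^sup>2 = 1"
  shows "lik (center a s) e w = row_const a * (\<Prod>j<p. exp (s j * (e * new_stat a w j)))"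
proof -
  have "shift_ratio (v j) (center a s j * e) (w j)
      = exp (- (a j)\<^sup>2 / (2 * v j)) * exp (s j * (e * new_stat a w j))" if "j < p" for j
  proof -
    have c: "center a s j = a j * s j"
      using that by (simp add: center_def)
    have "(center a s j * e)\<^sup>2 = (a j)\<^sup>2"
      unfolding c power_mult_distrib sign_square[OF assms(1) that] assms(2) by simp
    then have "shift_ratio (v j) (center a s j * e) (w j)
        = exp (- (a j)\<^sup>2 / (2 * v j) + center a s j * e * w j / v j)"
      by (simp add: shift_ratio_def)
    also have "center a s j * e * w j / v j = s j * (e * new_stat a w j)"
      by (simp add: c new_stat_def)
    finally show ?thesis
      by (simp only: exp_add)
  qed
  then show ?thesis
    unfolding lik_def row_const_def prod.distrib[symmetric] by (intro prod.cong) auto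
qed

lemma liks_center:
  assumes "s \<in> signs" "\<And>i. i < n \<Longrightarrow> (\<eta> i)\<^sup>2 = 1"
  shows "liks (center a s) \<eta> W = row_const a ^ n * (\<Prod>j<p. exp (s j * train_stat a \<eta> W j))"
proof -
  have "liks (center a s) \<eta> W
      = (\<Prod>i<n. row_const a * (\<Prod>j<p. exp (s j * (\<eta> i * new_stat a (W i) j))))"
    using assms by (simp add: liks_def lik_center)
  also have "\<dots> = row_const a ^ n * (\<Prod>i<n. \<Prod>j<p. exp (s j * (\<eta> i * new_stat a (W i) j)))"
    by (simp add: prod.distrib)
  also have "(\<Prod>i<n. \<Prod>j<p. exp (s j * (\<eta> i * new_stat a (W i) j)))
      = (\<Prod>j<p. \<Prod>i<n. exp (s j * (\<eta> i * new_stat a (W i) j)))"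
    by (rule prod.swap)
  also have "(\<Prod>j<p. \<Prod>i<n. exp (s j * (\<eta> i * new_stat a (W i) j)))
      = (\<Prod>j<p. exp (s j * train_stat a \<eta> W j))"
    by (intro prod.cong refl)
      (simp add: exp_sum[symmetric] train_stat_def new_stat_def sum_distrib_left mult_ac)
  finally show ?thesis .
qed

lemma nn_integral_lik_eq_1:
  "(\<integral>\<^sup>+z. ennreal (liks \<theta> \<eta> (fst z) * lik \<theta>' e (snd z)) \<partial>(noises \<Otimes>\<^sub>M noise)) = 1"
  using nn_integral_shift[of "\<lambda>_. 1" \<theta> \<eta> \<theta>' e] by (simp add: noise_pair.emeasure_space_1)

lemma nn_integral_pair_mult:
  assumes [measurable]: "f \<in> borel_measurable noises" "g \<in> borel_measurable noise"
  shows "(\<integral>\<^sup>+z. f (fst z) * g (snd z) \<partial>(noises \<Otimes>\<^sub>M noise)) = (\<integral>\<^sup>+W. f W \<partial>noises) * (\<integral>\<^sup>+w. g w \<partial>noise)"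
  by (subst noise.nn_integral_fst[symmetric]) (auto simp: nn_integral_cmult nn_integral_multc)

lemma nn_integral_train_stat:
  assumes "j < p" "s \<in> signs" and \<eta>: "\<And>i. i < n \<Longrightarrow> (\<eta> i)\<^sup>2 = 1"
  shows "(\<integral>\<^sup>+W. ennreal ((train_stat a \<eta> (observes (center a s) \<eta> W) j)\<^sup>2) \<partial>noises)
    = ennreal ((a j / v j)\<^sup>2 * ((real n)\<^sup>2 * (a j)\<^sup>2 + n * v j))"
proof -
  have s: "(s j)\<^sup>2 = 1"
    by (rule sign_square[OF assms(2,1)])
  have "train_stat a \<eta> (observes (center a s) \<eta> W) j
    = a j / v j * (n * (a j * s j) + (\<Sum>i<n. \<eta> i * W i j))" for W
  proof -
    have "(\<Sum>i<n. \<eta> i * observes (center a s) \<eta> W i j) = (\<Sum>i<n. a j * s j + \<eta> i * W i j)"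
    proof (intro sum.cong refl)
      fix i assume i: "i \<in> {..<n}"
      then have "\<eta> i * (\<eta> i * c) = c" for c
        using \<eta>[of i] by (simp add: power2_eq_square mult.assoc[symmetric])
      then show "\<eta> i * observes (center a s) \<eta> W i j = a j * s j + \<eta> i * W i j"
        using i assms(1) by (simp add: observes_def observe_def center_def algebra_simps)
    qed
    then show ?thesis
      by (simp add: train_stat_def sum.distrib)
  qed
  then have "(\<integral>\<^sup>+W. ennreal ((train_stat a \<eta> (observes (center a s) \<eta> W) j)\<^sup>2) \<partial>noises)
    = (\<integral>\<^sup>+W. ennreal ((a j / v j)\<^sup>2) * ennreal ((n * (a j * s j) + (\<Sum>i<n. \<eta> i * W i j))\<^sup>2) \<partial>noises)"
    by (simp only: power_mult_distrib ennreal_mult zero_le_power2)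
  also have "\<dots> = ennreal ((a j / v j)\<^sup>2) * (\<integral>\<^sup>+W. ennreal ((n * (a j * s j) + (\<Sum>i<n. \<eta> i * W i j))\<^sup>2) \<partial>noises)"
    unfolding noises_def
    by (rule nn_integral_cmult, rule measurable_compose[OF row_sum_measurable[OF assms(1)],
          where g = "\<lambda>t. ennreal ((n * (a j * s j) + t)\<^sup>2)"]) measurable
  also have "(\<integral>\<^sup>+W. ennreal ((n * (a j * s j) + (\<Sum>i<n. \<eta> i * W i j))\<^sup>2) \<partial>noises)
    = ennreal ((n * (a j * s j))\<^sup>2 + n * v j)"
    unfolding noises_def using nn_integral_row_sum_square[OF assms(1), of "{..<n}" \<eta>] \<eta> by simp
  finally show ?thesis
    using v_pos[of j] by (simp add: ennreal_mult[symmetric] power_mult_distrib s del: ennreal_plus)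
qed

lemma nn_integral_new_stat:
  assumes "j < p" "s \<in> signs"
  shows "(\<integral>\<^sup>+w. ennreal ((new_stat a (observe p (center a s) 1 w) j)\<^sup>2) \<partial>noise)
    = ennreal ((a j / v j)\<^sup>2 * ((a j)\<^sup>2 + v j))"
proof -
  have s: "(s j)\<^sup>2 = 1"
    by (rule sign_square[OF assms(2,1)])
  have "new_stat a (observe p (center a s) 1 w) j = a j / v j * (a j * s j + 1 * w j)" for w
    using assms(1) by (simp add: new_stat_def observe_def center_def)
  then have "(\<integral>\<^sup>+w. ennreal ((new_stat a (observe p (center a s) 1 w) j)\<^sup>2) \<partial>noise)
    = (\<integral>\<^sup>+w. ennreal ((a j / v j)\<^sup>2) * ennreal ((a j * s j + 1 * w j)\<^sup>2) \<partial>noise)"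
    by (simp only: power_mult_distrib ennreal_mult zero_le_power2)
  also have "\<dots> = ennreal ((a j / v j)\<^sup>2) * (\<integral>\<^sup>+w. ennreal ((a j * s j + 1 * w j)\<^sup>2) \<partial>noise)"
    by (rule nn_integral_cmult, rule measurable_compose[OF coord_measurable[OF assms(1)],
          where g = "\<lambda>t. ennreal ((a j * s j + 1 * t)\<^sup>2)"]) measurable
  also have "(\<integral>\<^sup>+w. ennreal ((a j * s j + 1 * w j)\<^sup>2) \<partial>noise) = ennreal ((a j * s j)\<^sup>2 + v j)"
    by (rule nn_integral_coord_square) (use assms in auto)
  finally show ?thesis
    using v_pos[of j] by (simp add: ennreal_mult[symmetric] power_mult_distrib s del: ennreal_plus)
qed

text \<open>
  The exponent lost between the reference density and the geometric mean of the two mixture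
  densities.  One shape with three parameters serves both regimes of the final argument: the loss
  \<open>\<bar>y\<bar>\<close>, linearised to \<open>\<kappa> + d * y\<^sup>2\<close>, and the loss \<open>b * x\<^sup>2 * y\<^sup>2\<close>.  In this way
  second moments are enough to compute its mean \<open>mean_cost\<close>.
\<close>

definition cost :: "real \<Rightarrow> real \<Rightarrow> real \<Rightarrow> (nat \<Rightarrow> real) \<Rightarrow> (nat \<Rightarrow> real) \<Rightarrow> real" where
  "cost \<kappa> d b x y = \<kappa> + (\<Sum>j<p. (d + b * (x j)\<^sup>2) * (y j)\<^sup>2)"

definition mean_cost :: "real \<Rightarrow> real \<Rightarrow> real \<Rightarrow> (nat \<Rightarrow> real) \<Rightarrow> real" where
  "mean_cost \<kappa> d b a = \<kappa> + (\<Sum>j<p. (d + b * ((a j / v j)\<^sup>2 * ((real n)\<^sup>2 * (a j)\<^sup>2 + n * v j)))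
      * ((a j / v j)\<^sup>2 * ((a j)\<^sup>2 + v j)))"

lemma cost_nonneg: "\<kappa> \<ge> 0 \<Longrightarrow> d \<ge> 0 \<Longrightarrow> b \<ge> 0 \<Longrightarrow> cost \<kappa> d b x y \<ge> 0"
  unfolding cost_def by (intro add_nonneg_nonneg sum_nonneg mult_nonneg_nonneg) auto

lemma cost_measurable[measurable]:
  "(\<lambda>z. cost \<kappa> d b (train_stat a \<eta> (fst z)) (new_stat a (snd z))) \<in> borel_measurable (noises \<Otimes>\<^sub>M noise)"
  unfolding cost_def by measurable

lemma nn_integral_cost:
  assumes nn: "\<kappa> \<ge> 0" "d \<ge> 0" "b \<ge> 0" and s: "s \<in> signs" "s' \<in> signs"
    and \<eta>: "\<And>i. i < n \<Longrightarrow> (\<eta> i)\<^sup>2 = 1"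
  shows "(\<integral>\<^sup>+z. ennreal (cost \<kappa> d b (train_stat a \<eta> (observes (center a s) \<eta> (fst z)))
      (new_stat a (observe p (center a s') 1 (snd z)))) \<partial>(noises \<Otimes>\<^sub>M noise)) = ennreal (mean_cost \<kappa> d b a)"
proof -
  let ?x = "\<lambda>W j. (train_stat a \<eta> (observes (center a s) \<eta> W) j)\<^sup>2"
  let ?y = "\<lambda>w j. (new_stat a (observe p (center a s') 1 w) j)\<^sup>2"
  let ?ex = "\<lambda>j. (a j / v j)\<^sup>2 * ((real n)\<^sup>2 * (a j)\<^sup>2 + n * v j)"
  let ?ey = "\<lambda>j. (a j / v j)\<^sup>2 * ((a j)\<^sup>2 + v j)"
  have obs[measurable]: "observe p (center a s') 1 \<in> measurable noise noise"
    by measurable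
  have xm[measurable]: "(\<lambda>W. ?x W j) \<in> borel_measurable noises" if "j < p" for j
    using that by measurable
  have ym[measurable]: "(\<lambda>w. ?y w j) \<in> borel_measurable noise" if "j < p" for j
    using that by measurable
  have e0: "?ex j \<ge> 0" "?ey j \<ge> 0" for j
    using v_pos[of j] by auto
  have "(\<integral>\<^sup>+z. ennreal (cost \<kappa> d b (train_stat a \<eta> (observes (center a s) \<eta> (fst z)))
      (new_stat a (observe p (center a s') 1 (snd z)))) \<partial>(noises \<Otimes>\<^sub>M noise))
    = (\<integral>\<^sup>+z. ennreal \<kappa> + (\<Sum>j<p. ennreal (d + b * ?x (fst z) j) * ennreal (?y (snd z) j)) \<partial>(noises \<Otimes>\<^sub>M noise))"
    unfolding cost_def using nn
    by (intro nn_integral_cong) (simp add: ennreal_plus sum_nonneg sum_ennreal[symmetric] ennreal_mult)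
  also have "\<dots> = ennreal \<kappa> + (\<Sum>j<p. \<integral>\<^sup>+z. ennreal (d + b * ?x (fst z) j) * ennreal (?y (snd z) j) \<partial>(noises \<Otimes>\<^sub>M noise))"
  proof -
    have tm: "(\<lambda>z. ennreal (d + b * ?x (fst z) j) * ennreal (?y (snd z) j)) \<in> borel_measurable (noises \<Otimes>\<^sub>M noise)"
      if "j \<in> {..<p}" for j
    proof -
      have [measurable]: "(\<lambda>W. ?x W j) \<in> borel_measurable noises" "(\<lambda>w. ?y w j) \<in> borel_measurable noise"
        using that xm ym by auto
      show ?thesis
        by measurable
    qed
    have "(\<integral>\<^sup>+z. (\<Sum>j<p. ennreal (d + b * ?x (fst z) j) * ennreal (?y (snd z) j)) \<partial>(noises \<Otimes>\<^sub>M noise))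
      = (\<Sum>j<p. \<integral>\<^sup>+z. ennreal (d + b * ?x (fst z) j) * ennreal (?y (snd z) j) \<partial>(noises \<Otimes>\<^sub>M noise))"
      by (intro nn_integral_sum tm)
    moreover have "(\<lambda>z. \<Sum>j<p. ennreal (d + b * ?x (fst z) j) * ennreal (?y (snd z) j))
        \<in> borel_measurable (noises \<Otimes>\<^sub>M noise)"
      by (intro borel_measurable_sum tm)
    ultimately show ?thesis
      by (subst nn_integral_add) (auto simp: noise_pair.emeasure_space_1)
  qed
  also have "\<dots> = ennreal \<kappa> + (\<Sum>j<p. ennreal ((d + b * ?ex j) * ?ey j))"
  proof (intro arg_cong2[where f = "(+)"] sum.cong refl)
    fix j assume "j \<in> {..<p}"
    then have j: "j < p"
      by simp
    have "(\<integral>\<^sup>+W. ennreal (d + b * ?x W j) \<partial>noises) = (\<integral>\<^sup>+W. ennreal d + ennreal b * ennreal (?x W j) \<partial>noises)"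
      using nn by (simp add: ennreal_plus ennreal_mult)
    also have "\<dots> = ennreal d + ennreal b * ennreal (?ex j)"
      using j nn_integral_train_stat[OF j s(1) \<eta>, where a = a]
      by (subst nn_integral_add) (auto simp: nn_integral_cmult noises.emeasure_space_1)
    also have "\<dots> = ennreal (d + b * ?ex j)"
      unfolding ennreal_mult[OF nn(3) e0(1), symmetric]
      by (intro ennreal_plus[symmetric] nn mult_nonneg_nonneg e0)
    finally have "(\<integral>\<^sup>+W. ennreal (d + b * ?x W j) \<partial>noises) = ennreal (d + b * ?ex j)" .
    then have "(\<integral>\<^sup>+z. ennreal (d + b * ?x (fst z) j) * ennreal (?y (snd z) j) \<partial>(noises \<Otimes>\<^sub>M noise))
      = ennreal (d + b * ?ex j) * ennreal (?ey j)"
      using j nn_integral_new_stat[OF j s(2), where a = a] by (subst nn_integral_pair_mult) auto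
    also have "\<dots> = ennreal ((d + b * ?ex j) * ?ey j)"
      using nn e0[of j] by (intro ennreal_mult[symmetric]) auto
    finally show "(\<integral>\<^sup>+z. ennreal (d + b * ?x (fst z) j) * ennreal (?y (snd z) j) \<partial>(noises \<Otimes>\<^sub>M noise))
      = ennreal ((d + b * ?ex j) * ?ey j)" .
  qed
  also have "\<dots> = ennreal (mean_cost \<kappa> d b a)"
  proof -
    have t0: "(d + b * ?ex j) * ?ey j \<ge> 0" for j
      using nn by (intro mult_nonneg_nonneg add_nonneg_nonneg) (simp_all add: v_pos less_imp_le)
    show ?thesis
      unfolding mean_cost_def using nn t0
      by (subst sum_ennreal) (auto intro!: ennreal_plus[symmetric] sum_nonneg simp del: times_divide_eq_left)
  qed
  finally show ?thesis .
qed

text \<open>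
  Sums over the sign vectors, without the weights \<open>1 / 2 ^ p\<close>.  In \<open>mix\<close> sample and new observation
  share the signs, in \<open>mix0\<close> their signs are independent, and by the symmetry of the sign vectors
  either label of the new observation gives the same sum.
\<close>

definition mix :: "(nat \<Rightarrow> real) \<Rightarrow> (nat \<Rightarrow> real) \<Rightarrow> real \<Rightarrow> (nat \<Rightarrow> nat \<Rightarrow> real) \<times> (nat \<Rightarrow> real) \<Rightarrow> real" where
  "mix a \<eta> e z = (\<Sum>s\<in>signs. liks (center a s) \<eta> (fst z) * lik (center a s) e (snd z))"

definition mix0 :: "(nat \<Rightarrow> real) \<Rightarrow> (nat \<Rightarrow> real) \<Rightarrow> (nat \<Rightarrow> nat \<Rightarrow> real) \<times> (nat \<Rightarrow> real) \<Rightarrow> real" where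
  "mix0 a \<eta> z = (\<Sum>s\<in>signs. \<Sum>s'\<in>signs. liks (center a s) \<eta> (fst z) * lik (center a s') 1 (snd z))"

lemma mix_nonneg: "mix a \<eta> e z \<ge> 0" and mix0_nonneg: "mix0 a \<eta> z \<ge> 0"
  by (auto simp: mix_def mix0_def intro!: sum_nonneg)

lemma mix_measurable[measurable]: "mix a \<eta> e \<in> borel_measurable (noises \<Otimes>\<^sub>M noise)"
  and mix0_measurable[measurable]: "mix0 a \<eta> \<in> borel_measurable (noises \<Otimes>\<^sub>M noise)"
  unfolding mix_def[abs_def] mix0_def[abs_def] by measurable

lemma mix_eq:
  assumes "e\<^sup>2 = 1" "\<And>i. i < n \<Longrightarrow> (\<eta> i)\<^sup>2 = 1"
  shows "mix a \<eta> e z = row_const a ^ Suc n * 2 ^ p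
    * (\<Prod>j<p. cosh (train_stat a \<eta> (fst z) j + e * new_stat a (snd z) j))"
proof -
  have "mix a \<eta> e z = (\<Sum>s\<in>signs. row_const a ^ Suc n
      * (\<Prod>j<p. exp (s j * (train_stat a \<eta> (fst z) j + e * new_stat a (snd z) j))))"
    unfolding mix_def using assms
    by (intro sum.cong refl)
      (simp add: lik_center liks_center prod.distrib[symmetric] exp_add[symmetric] algebra_simps)
  then show ?thesis
    by (simp add: sum_distrib_left[symmetric] sum_signs_exp mult_ac)
qed

lemma mix0_eq:
  assumes "\<And>i. i < n \<Longrightarrow> (\<eta> i)\<^sup>2 = 1"
  shows "mix0 a \<eta> z / 2 ^ p = row_const a ^ Suc n * 2 ^ p
    * (\<Prod>j<p. cosh (train_stat a \<eta> (fst z) j) * cosh (new_stat a (snd z) j))"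
proof -
  have "mix0 a \<eta> z = (\<Sum>s\<in>signs. liks (center a s) \<eta> (fst z)) * (\<Sum>s\<in>signs. lik (center a s) 1 (snd z))"
    by (simp add: mix0_def sum_product)
  also have "(\<Sum>s\<in>signs. liks (center a s) \<eta> (fst z))
      = row_const a ^ n * (2 ^ p * (\<Prod>j<p. cosh (train_stat a \<eta> (fst z) j)))"
    using assms by (simp add: liks_center sum_distrib_left[symmetric] sum_signs_exp)
  also have "(\<Sum>s\<in>signs. lik (center a s) 1 (snd z))
      = row_const a * (2 ^ p * (\<Prod>j<p. cosh (new_stat a (snd z) j)))"
    by (simp add: lik_center sum_distrib_left[symmetric] sum_signs_exp)
  finally show ?thesis
    by (simp add: prod.distrib mult_ac)
qed

lemma nn_integral_mix: "(\<integral>\<^sup>+z. ennreal (mix a \<eta> e z) \<partial>(noises \<Otimes>\<^sub>M noise)) = ennreal (2 ^ p)"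
proof -
  have "(\<integral>\<^sup>+z. ennreal (mix a \<eta> e z) \<partial>(noises \<Otimes>\<^sub>M noise)) = (\<integral>\<^sup>+z. (\<Sum>s\<in>signs.
      ennreal (liks (center a s) \<eta> (fst z) * lik (center a s) e (snd z))) \<partial>(noises \<Otimes>\<^sub>M noise))"
    by (intro nn_integral_cong) (simp add: mix_def)
  also have "\<dots> = (\<Sum>s\<in>signs. 1)"
    by (subst nn_integral_sum) (auto simp: nn_integral_lik_eq_1)
  finally show ?thesis
    by (simp add: card_signs ennreal_power[symmetric])
qed

lemma nn_integral_times_mix:
  assumes [measurable]: "F \<in> borel_measurable (noises \<Otimes>\<^sub>M noise)"
  shows "(\<integral>\<^sup>+z. F z * ennreal (mix a \<eta> e z) \<partial>(noises \<Otimes>\<^sub>M noise))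
    = (\<Sum>s\<in>signs. \<integral>\<^sup>+z. F (observes (center a s) \<eta> (fst z), observe p (center a s) e (snd z)) \<partial>(noises \<Otimes>\<^sub>M noise))"
proof -
  have "(\<integral>\<^sup>+z. F z * ennreal (mix a \<eta> e z) \<partial>(noises \<Otimes>\<^sub>M noise)) = (\<integral>\<^sup>+z. (\<Sum>s\<in>signs.
      F z * ennreal (liks (center a s) \<eta> (fst z) * lik (center a s) e (snd z))) \<partial>(noises \<Otimes>\<^sub>M noise))"
    by (intro nn_integral_cong) (simp add: mix_def sum_distrib_left[symmetric])
  also have "\<dots> = (\<Sum>s\<in>signs. \<integral>\<^sup>+z. F (observes (center a s) \<eta> (fst z), observe p (center a s) e (snd z)) \<partial>(noises \<Otimes>\<^sub>M noise))"
    by (subst nn_integral_sum) (auto simp: nn_integral_shift)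
  finally show ?thesis .
qed

lemma nn_integral_times_mix0:
  assumes [measurable]: "F \<in> borel_measurable (noises \<Otimes>\<^sub>M noise)"
  shows "(\<integral>\<^sup>+z. F z * ennreal (mix0 a \<eta> z) \<partial>(noises \<Otimes>\<^sub>M noise))
    = (\<Sum>s\<in>signs. \<Sum>s'\<in>signs.
        \<integral>\<^sup>+z. F (observes (center a s) \<eta> (fst z), observe p (center a s') 1 (snd z)) \<partial>(noises \<Otimes>\<^sub>M noise))"
proof -
  have "(\<integral>\<^sup>+z. F z * ennreal (mix0 a \<eta> z) \<partial>(noises \<Otimes>\<^sub>M noise)) = (\<integral>\<^sup>+z. (\<Sum>s\<in>signs. \<Sum>s'\<in>signs.
      F z * ennreal (liks (center a s) \<eta> (fst z) * lik (center a s') 1 (snd z))) \<partial>(noises \<Otimes>\<^sub>M noise))"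
    by (intro nn_integral_cong) (simp add: mix0_def sum_distrib_left[symmetric] sum_nonneg)
  also have "\<dots> = (\<Sum>s\<in>signs. \<Sum>s'\<in>signs.
        \<integral>\<^sup>+z. F (observes (center a s) \<eta> (fst z), observe p (center a s') 1 (snd z)) \<partial>(noises \<Otimes>\<^sub>M noise))"
    by (simp add: nn_integral_sum nn_integral_shift)
  finally show ?thesis .
qed

text \<open>
  Any test between the two mixtures, even a randomised one, has a total error of at least
  \<open>exp (- 2 * mean_cost) / 2\<close>, up to the number \<open>2 ^ p\<close> of sign vectors.  The functions \<open>F e\<close> are the
  rejection probabilities of the label \<open>e\<close>; the condition that they add up to at least one is what
  being forced to decide means.
\<close>

lemma mixture_test_error:
  assumes nn: "\<kappa> \<ge> 0" "d \<ge> 0" "b \<ge> 0" and \<eta>: "\<And>i. i < n \<Longrightarrow> (\<eta> i)\<^sup>2 = 1"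
    and overlap: "\<And>x y. (\<And>j. j < p \<Longrightarrow> a j = 0 \<Longrightarrow> x j = 0 \<and> y j = 0) \<Longrightarrow>
      (\<Prod>j<p. cosh (x j) * cosh (y j))\<^sup>2 * exp (- 2 * cost \<kappa> d b x y)
        \<le> (\<Prod>j<p. cosh (x j + y j) * cosh (x j - y j))"
    and F[measurable]: "\<And>e. F e \<in> borel_measurable (noises \<Otimes>\<^sub>M noise)"
    and F1: "\<And>z. z \<in> space (noises \<Otimes>\<^sub>M noise) \<Longrightarrow> F (-1) z + F 1 z \<ge> (1 :: ennreal)"
  shows "ennreal (2 ^ p * exp (- 2 * mean_cost \<kappa> d b a) / 2)
    \<le> (\<Sum>e\<in>{-1, 1}. \<Sum>s\<in>signs.
        \<integral>\<^sup>+z. F e (observes (center a s) \<eta> (fst z), observe p (center a s) e (snd z)) \<partial>(noises \<Otimes>\<^sub>M noise))"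
proof -
  define m where "m = mean_cost \<kappa> d b a"
  define B where "B = exp (- 2 * m)"
  define N :: real where "N = 2 ^ p"
  define X where "X z = cost \<kappa> d b (train_stat a \<eta> (fst z)) (new_stat a (snd z))" for z
  let ?g = "mix a \<eta>" and ?h = "mix0 a \<eta>" and ?M = "noises \<Otimes>\<^sub>M noise"
  have [measurable]: "X \<in> borel_measurable ?M"
    unfolding X_def[abs_def] by measurable
  have X0: "X z \<ge> 0" for z
    unfolding X_def by (rule cost_nonneg[OF nn])
  have m0: "m \<ge> 0"
    unfolding m_def mean_cost_def using nn v_pos
    by (intro add_nonneg_nonneg sum_nonneg mult_nonneg_nonneg) (auto simp: less_imp_le)
  have B: "B > 0" and N: "N > 0"
    by (auto simp: B_def N_def)
  have pointwise: "B * (1 + m) * (?h z / N)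
      \<le> min (?g 1 z) (?g (-1) z) + B * (X z * (?h z / N)) + B / 4 * (?g 1 z + ?g (-1) z)" for z
    unfolding B_def
  proof (rule min_ge_affine_overlap)
    let ?x = "train_stat a \<eta> (fst z)" and ?y = "new_stat a (snd z)"
    let ?c = "row_const a ^ Suc n * 2 ^ p"
    have "(?h z / N)\<^sup>2 * exp (- 2 * X z)
      = ?c\<^sup>2 * ((\<Prod>j<p. cosh (?x j) * cosh (?y j))\<^sup>2 * exp (- 2 * X z))"
      unfolding N_def using \<eta> by (subst mix0_eq) (simp_all only: power_mult_distrib mult.assoc)
    also have "\<dots> \<le> ?c\<^sup>2 * (\<Prod>j<p. cosh (?x j + ?y j) * cosh (?x j - ?y j))"
      unfolding X_def
      by (intro mult_left_mono overlap) (auto simp: train_stat_def new_stat_def)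
    also have "\<dots> = ?g 1 z * ?g (-1) z"
      using \<eta> by (simp add: mix_eq prod.distrib power2_eq_square)
    finally show "(?h z / N)\<^sup>2 * exp (- 2 * X z) \<le> ?g 1 z * ?g (-1) z" .
  qed (use N in \<open>auto simp: mix_nonneg mix0_nonneg\<close>)
  let ?T = "(\<integral>\<^sup>+z. F 1 z * ennreal (?g 1 z) \<partial>?M) + (\<integral>\<^sup>+z. F (-1) z * ennreal (?g (-1) z) \<partial>?M)"
  have "(\<integral>\<^sup>+z. ennreal (B * (1 + m) / N) * ennreal (?h z) \<partial>?M)
    \<le> (\<integral>\<^sup>+z. (F 1 z * ennreal (?g 1 z) + F (-1) z * ennreal (?g (-1) z))
        + ennreal (B / N) * (ennreal (X z) * ennreal (?h z))
        + ennreal (B / 4) * (ennreal (?g 1 z) + ennreal (?g (-1) z)) \<partial>?M)"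
  proof (intro nn_integral_mono)
    fix z assume z: "z \<in> space ?M"
    let ?mn = "min (?g 1 z) (?g (-1) z)"
    have mn: "?mn \<ge> 0"
      by (simp add: mix_nonneg)
    have "ennreal ?mn * 1 \<le> ennreal ?mn * (F (-1) z + F 1 z)"
      by (intro mult_left_mono F1 z) auto
    also have "\<dots> = F 1 z * ennreal ?mn + F (-1) z * ennreal ?mn"
      by (simp add: distrib_left distrib_right mult.commute add.commute)
    also have "\<dots> \<le> F 1 z * ennreal (?g 1 z) + F (-1) z * ennreal (?g (-1) z)"
      by (intro add_mono mult_left_mono ennreal_leI) auto
    finally have mnF: "ennreal ?mn \<le> F 1 z * ennreal (?g 1 z) + F (-1) z * ennreal (?g (-1) z)"
      by simp
    have "ennreal (B * (1 + m) / N) * ennreal (?h z) = ennreal (B * (1 + m) * (?h z / N))"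
      using B N m0 by (simp add: ennreal_mult[symmetric] mix0_nonneg)
    also have "\<dots> \<le> ennreal (?mn + B * (X z * (?h z / N)) + B / 4 * (?g 1 z + ?g (-1) z))"
      by (intro ennreal_leI pointwise)
    also have "\<dots> = ennreal ?mn + ennreal (B * (X z * (?h z / N))) + ennreal (B / 4 * (?g 1 z + ?g (-1) z))"
      using B N mn X0[of z] by (simp add: ennreal_plus mix_nonneg mix0_nonneg)
    also have "ennreal (B * (X z * (?h z / N))) = ennreal (B / N) * (ennreal (X z) * ennreal (?h z))"
      using B N X0[of z] by (simp add: ennreal_mult[symmetric] mix0_nonneg)
    also have "ennreal (B / 4 * (?g 1 z + ?g (-1) z)) = ennreal (B / 4) * (ennreal (?g 1 z) + ennreal (?g (-1) z))"
      using B by (subst ennreal_mult) (auto simp: ennreal_plus mix_nonneg intro!: add_nonneg_nonneg)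
    finally show "ennreal (B * (1 + m) / N) * ennreal (?h z)
      \<le> (F 1 z * ennreal (?g 1 z) + F (-1) z * ennreal (?g (-1) z))
        + ennreal (B / N) * (ennreal (X z) * ennreal (?h z))
        + ennreal (B / 4) * (ennreal (?g 1 z) + ennreal (?g (-1) z))"
      using mnF by (meson add_mono order.trans order_refl)
  qed
  also have "(\<integral>\<^sup>+z. ennreal (B * (1 + m) / N) * ennreal (?h z) \<partial>?M)
      = ennreal (B * (1 + m) / N) * (\<integral>\<^sup>+z. 1 * ennreal (?h z) \<partial>?M)"
    by (subst nn_integral_cmult) auto
  also have "(\<integral>\<^sup>+z. 1 * ennreal (?h z) \<partial>?M) = ennreal (N * N)"
    by (subst nn_integral_times_mix0)
      (simp_all add: noise_pair.emeasure_space_1 card_signs N_def ennreal_mult ennreal_power[symmetric])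
  also have "(\<integral>\<^sup>+z. (F 1 z * ennreal (?g 1 z) + F (-1) z * ennreal (?g (-1) z))
        + ennreal (B / N) * (ennreal (X z) * ennreal (?h z))
        + ennreal (B / 4) * (ennreal (?g 1 z) + ennreal (?g (-1) z)) \<partial>?M)
     = ?T + ennreal (B / N) * (\<integral>\<^sup>+z. ennreal (X z) * ennreal (?h z) \<partial>?M)
        + ennreal (B / 4) * (ennreal N + ennreal N)"
    by (simp add: nn_integral_add nn_integral_cmult nn_integral_mix N_def)
  also have "(\<integral>\<^sup>+z. ennreal (X z) * ennreal (?h z) \<partial>?M) = ennreal (N * N) * ennreal m"
  proof -
    have "(\<integral>\<^sup>+z. ennreal (X z) * ennreal (?h z) \<partial>?M) = (\<Sum>s\<in>signs. \<Sum>s'\<in>signs. ennreal m)"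
      unfolding X_def m_def using nn_integral_cost[OF nn _ _ \<eta>]
      by (subst nn_integral_times_mix0) (auto intro!: sum.cong)
    also have "\<dots> = ennreal (N * N) * ennreal m"
      by (simp add: card_signs N_def ennreal_mult ennreal_power[symmetric] mult.assoc)
    finally show ?thesis .
  qed
  finally have main: "ennreal (B * (1 + m) / N) * ennreal (N * N)
      \<le> ?T + ennreal (B / N) * (ennreal (N * N) * ennreal m) + ennreal (B / 4) * (ennreal N + ennreal N)" .
  have "ennreal (N * B / 2) \<le> ?T"
  proof (cases "?T = \<infinity>")
    case True
    show ?thesis
      unfolding True by simp
  next
    case False
    define t where "t = enn2real ?T"
    have t: "?T = ennreal t" "t \<ge> 0"
      using False unfolding t_def infinity_ennreal_def
      by (intro ennreal_enn2real[symmetric] enn2real_nonneg; simp only: less_top)+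
    define u w where "u = B / N * (N * N * m)" and "w = B / 4 * (N + N)"
    have nonneg: "B * (1 + m) / N \<ge> 0" "N * N \<ge> 0" "B / N \<ge> 0" "N * N * m \<ge> 0" "B / 4 \<ge> 0" "N \<ge> 0" "N + N \<ge> 0"
      using B N m0 by auto
    have "u \<ge> 0" "w \<ge> 0"
      unfolding u_def w_def by (intro mult_nonneg_nonneg nonneg)+
    have "ennreal (B * (1 + m) / N * (N * N)) = ennreal (B * (1 + m) / N) * ennreal (N * N)"
      by (intro ennreal_mult nonneg)
    also note main
    also have "ennreal (B / N) * (ennreal (N * N) * ennreal m) = ennreal u"
      unfolding u_def ennreal_mult[OF nonneg(3,4)] ennreal_mult[OF nonneg(2) m0] ..
    also have "ennreal (B / 4) * (ennreal N + ennreal N) = ennreal w"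
      unfolding w_def ennreal_mult[OF nonneg(5,7)] ennreal_plus[OF nonneg(6,6)] ..
    also have "?T + ennreal u + ennreal w = ennreal (t + u + w)"
      using t \<open>u \<ge> 0\<close> \<open>w \<ge> 0\<close> by (simp only: ennreal_plus add_nonneg_nonneg)
    finally have "B * (1 + m) / N * (N * N) \<le> t + u + w"
      using t \<open>u \<ge> 0\<close> \<open>w \<ge> 0\<close> by (subst (asm) ennreal_le_iff) auto
    moreover have "B * (1 + m) / N * (N * N) = B * (1 + m) * N" "u = B * m * N"
      using N by (auto simp: u_def)
    ultimately have "N * B / 2 \<le> t"
      by (simp add: w_def algebra_simps)
    then show ?thesis
      using t by (simp add: ennreal_leI)
  qed
  then show ?thesis
    by (simp add: nn_integral_times_mix B_def N_def m_def add.commute)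
qed

end

section \<open>Generalization error as a testing error\<close>

lemma observe_joint_measurable:
  assumes f: "f \<in> borel_measurable M" and g: "g \<in> measurable M (obs_space p)"
  shows "(\<lambda>x. observe p \<theta> (f x) (g x)) \<in> measurable M (obs_space p)"
  unfolding observe_def obs_space_def
proof (rule measurable_restrict)
  fix j assume "j \<in> {..<p}"
  then have [measurable]: "(\<lambda>x. g x j) \<in> borel_measurable M"
    using g unfolding obs_space_def by (rule measurable_compose[OF _ measurable_component_singleton, rotated])
  note f[measurable]
  show "(\<lambda>x. \<theta> j * f x + g x j) \<in> borel_measurable M"
    by measurable
qed

lemma label_space_ident: "(\<lambda>x. x) \<in> borel_measurable label_space"
  unfolding label_space_def by simp

lemma classifier_borel:
  assumes "h \<in> classifiers n p"
  shows "h \<in> borel_measurable (data_space n p \<Otimes>\<^sub>M obs_space p)"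
  using measurable_compose[OF _ label_space_ident] assms by (simp add: classifiers_def)

text \<open>
  The probability that a new observation with label \<open>e\<close> is misclassified, in \<open>ennreal\<close> so that
  Fubini's theorem applies without integrability conditions.
\<close>

definition label_error ::
  "nat \<Rightarrow> real mat \<Rightarrow> (nat \<Rightarrow> real) \<Rightarrow> ((nat \<Rightarrow> (nat \<Rightarrow> real) \<times> real) \<times> (nat \<Rightarrow> real) \<Rightarrow> real)
    \<Rightarrow> real \<Rightarrow> (nat \<Rightarrow> (nat \<Rightarrow> real) \<times> real) \<Rightarrow> ennreal" where
  "label_error p S \<theta> h e D = (\<integral>\<^sup>+w. (if h (D, observe p \<theta> e w) \<noteq> e then 1 else 0) \<partial>gaussian p S)"

lemma label_error_measurable:
  assumes h: "h \<in> classifiers n p" and S: "pos_def_mat p S"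
  shows "label_error p S \<theta> h e \<in> borel_measurable (data_space n p)"
proof -
  interpret P: prob_space "gaussian p S"
    by (rule prob_space_gaussian[OF S])
  have "(\<lambda>x. observe p \<theta> e (snd x)) \<in> measurable (data_space n p \<Otimes>\<^sub>M gaussian p S) (obs_space p)"
    by (rule observe_joint_measurable) (auto cong: measurable_cong_sets simp: sets_gaussian)
  then have [measurable]: "(\<lambda>x. h (fst x, observe p \<theta> e (snd x))) \<in> borel_measurable (data_space n p \<Otimes>\<^sub>M gaussian p S)"
    by (intro measurable_compose[OF _ classifier_borel[OF h]] measurable_Pair) auto
  have "(\<lambda>x. if h (fst x, observe p \<theta> e (snd x)) \<noteq> e then 1 else 0 :: ennreal)
      \<in> borel_measurable (data_space n p \<Otimes>\<^sub>M gaussian p S)"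
    by measurable
  then show ?thesis
    unfolding label_error_def[abs_def]
    by (intro P.borel_measurable_nn_integral) (simp add: split_beta')
qed

lemma gen_error_eq:
  assumes h: "h \<in> classifiers n p" and S: "pos_def_mat p S" and D: "D \<in> space (data_space n p)"
  shows "ennreal (gen_error p S \<theta> h D)
    = ennreal (1 / 2) * (label_error p S \<theta> h (-1) D + label_error p S \<theta> h 1 D)"
    and "gen_error p S \<theta> h D \<le> 1"
proof -
  let ?U = "uniform_count_measure {-1, 1 :: real}"
  interpret P: prob_space "gaussian p S"
    by (rule prob_space_gaussian[OF S])
  interpret U: prob_space ?U
    by (rule prob_space_uniform_count_measure) auto
  interpret UP: pair_prob_space ?U "gaussian p S" ..
  let ?M = "?U \<Otimes>\<^sub>M gaussian p S"
  define E where "E = {(e, w) \<in> space ?M. h (D, observe p \<theta> e w) \<noteq> e}"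
  have e[measurable]: "fst \<in> borel_measurable ?M"
    using measurable_compose[OF measurable_fst, of "\<lambda>x. x" ?U borel "gaussian p S"]
    by (simp cong: measurable_cong_sets add: sets_uniform_count_measure_count_space)
  have "(\<lambda>x. observe p \<theta> (fst x) (snd x)) \<in> measurable ?M (obs_space p)"
    by (rule observe_joint_measurable[OF e]) (auto cong: measurable_cong_sets simp: sets_gaussian)
  then have [measurable]: "(\<lambda>x. h (D, observe p \<theta> (fst x) (snd x))) \<in> borel_measurable ?M"
    using D by (intro measurable_compose[OF _ classifier_borel[OF h]] measurable_Pair) auto
  have "E = {x \<in> space ?M. h (D, observe p \<theta> (fst x) (snd x)) \<noteq> fst x}"
    by (auto simp: E_def)
  then have E: "E \<in> sets ?M"
    by simp
  have gen: "gen_error p S \<theta> h D = measure ?M E"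
    by (simp add: gen_error_def E_def Let_def)
  then show "gen_error p S \<theta> h D \<le> 1"
    by simp
  have "ennreal (gen_error p S \<theta> h D) = emeasure ?M E"
    by (simp add: gen UP.emeasure_eq_measure)
  also have "\<dots> = (\<integral>\<^sup>+e. (\<integral>\<^sup>+w. indicator E (e, w) \<partial>gaussian p S) \<partial>?U)"
    by (rule P.emeasure_pair_measure[OF E])
  also have "\<dots> = (\<integral>\<^sup>+e. label_error p S \<theta> h e D \<partial>?U)"
  proof (intro nn_integral_cong)
    fix e assume e: "e \<in> space ?U"
    show "(\<integral>\<^sup>+w. indicator E (e, w) \<partial>gaussian p S) = label_error p S \<theta> h e D"
      unfolding label_error_def using e
      by (intro nn_integral_cong) (auto simp: E_def space_pair_measure)
  qed
  also have "\<dots> = ennreal (1 / 2) * (label_error p S \<theta> h (-1) D + label_error p S \<theta> h 1 D)"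
    unfolding uniform_count_measure_def
    by (subst nn_integral_point_measure_finite) (auto simp: distrib_left)
  finally show "ennreal (gen_error p S \<theta> h D)
    = ennreal (1 / 2) * (label_error p S \<theta> h (-1) D + label_error p S \<theta> h 1 D)" .
qed

lemma training_map_measurable:
  assumes \<nu>: "sets \<nu> = sets (labels_space n)"
  shows "(\<lambda>(\<eta>, W). \<lambda>i\<in>{..<n}. (observe p \<theta> (\<eta> i) (W i), \<eta> i))
    \<in> measurable (\<nu> \<Otimes>\<^sub>M (\<Pi>\<^sub>M i\<in>{..<n}. gaussian p S)) (data_space n p)"
proof -
  let ?N = "\<nu> \<Otimes>\<^sub>M (\<Pi>\<^sub>M i\<in>{..<n}. gaussian p S)"
  have "(\<lambda>x. \<lambda>i\<in>{..<n}. (observe p \<theta> (fst x i) (snd x i), fst x i)) \<in> measurable ?N (data_space n p)"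
    unfolding data_space_def
  proof (intro measurable_restrict measurable_Pair observe_joint_measurable)
    fix i assume i: "i \<in> {..<n}"
    have "fst \<in> measurable ?N (labels_space n)"
      using \<nu> by (simp cong: measurable_cong_sets)
    then show l: "(\<lambda>x. fst x i) \<in> measurable ?N label_space"
      unfolding labels_space_def by (rule measurable_compose[OF _ measurable_component_singleton[OF i]])
    show "(\<lambda>x. fst x i) \<in> borel_measurable ?N"
      by (rule measurable_compose[OF l label_space_ident])
    have "(\<lambda>x. snd x i) \<in> measurable ?N (gaussian p S)"
      by (rule measurable_compose[OF measurable_snd measurable_component_singleton[OF i]])
    then show "(\<lambda>x. snd x i) \<in> measurable ?N (obs_space p)"
      by (simp cong: measurable_cong_sets add: sets_gaussian)
  qed
  then show ?thesis
    by (simp add: split_beta')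
qed

text \<open>
  The labels are integrated last, because the testing bound is applied to one label vector at a time.
\<close>

lemma expected_gen_error_eq:
  assumes h: "h \<in> classifiers n p" and S: "pos_def_mat p S"
    and \<nu>: "prob_space \<nu>" "sets \<nu> = sets (labels_space n)"
  shows "ennreal (expected_gen_error n p \<nu> S \<theta> h)
      = (\<integral>\<^sup>+\<eta>. (\<integral>\<^sup>+W. ennreal (1 / 2) *
          (label_error p S \<theta> h (-1) (\<lambda>i\<in>{..<n}. (observe p \<theta> (\<eta> i) (W i), \<eta> i))
            + label_error p S \<theta> h 1 (\<lambda>i\<in>{..<n}. (observe p \<theta> (\<eta> i) (W i), \<eta> i)))
          \<partial>(\<Pi>\<^sub>M i\<in>{..<n}. gaussian p S)) \<partial>\<nu>)"
    and "0 \<le> expected_gen_error n p \<nu> S \<theta> h" "expected_gen_error n p \<nu> S \<theta> h \<le> 1"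
proof -
  let ?W = "\<Pi>\<^sub>M i\<in>{..<n}. gaussian p S"
  let ?T = "\<lambda>(\<eta>, W). \<lambda>i\<in>{..<n}. (observe p \<theta> (\<eta> i) (W i), \<eta> i)"
  let ?TL = "training_law n p \<nu> S \<theta>"
  define err where "err D = ennreal (1 / 2) * (label_error p S \<theta> h (-1) D + label_error p S \<theta> h 1 D)" for D
  interpret \<nu>: prob_space \<nu> by fact
  interpret W: prob_space ?W
    by (intro prob_space_PiM prob_space_gaussian S)
  interpret NW: pair_prob_space \<nu> ?W ..
  have T: "?T \<in> measurable (\<nu> \<Otimes>\<^sub>M ?W) (data_space n p)"
    by (rule training_map_measurable[OF \<nu>(2)])
  interpret TL: prob_space ?TL
    unfolding training_law_def by (rule NW.prob_space_distr[OF T])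
  have sets_TL: "sets ?TL = sets (data_space n p)"
    by (simp add: training_law_def)
  have space_TL: "space ?TL = space (data_space n p)"
    by (simp add: training_law_def)
  have err[measurable]: "err \<in> borel_measurable (data_space n p)"
    unfolding err_def[abs_def]
    by (intro borel_measurable_times_ennreal borel_measurable_const borel_measurable_add
        label_error_measurable[OF h S])
  have gen: "ennreal (gen_error p S \<theta> h D) = err D" "gen_error p S \<theta> h D \<le> 1"
    if "D \<in> space (data_space n p)" for D
    using gen_error_eq[OF h S that] by (auto simp: err_def)
  have gen0: "gen_error p S \<theta> h D \<ge> 0" for D
    by (simp add: gen_error_def Let_def)
  have "gen_error p S \<theta> h \<in> borel_measurable (data_space n p)"
  proof (subst measurable_cong)
    show "gen_error p S \<theta> h D = enn2real (err D)" if "D \<in> space (data_space n p)" for D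
      using gen(1)[OF that] gen0[of D] by (metis enn2real_ennreal)
  qed measurable
  then have meas: "gen_error p S \<theta> h \<in> borel_measurable ?TL"
    by (simp cong: measurable_cong_sets add: sets_TL)
  have int: "integrable ?TL (gen_error p S \<theta> h)"
    by (rule TL.integrable_const_bound[OF _ meas, of 1]) (use gen(2) gen0 space_TL in auto)
  show "0 \<le> expected_gen_error n p \<nu> S \<theta> h"
    unfolding expected_gen_error_def using gen0 by (intro integral_nonneg_AE) auto
  show "expected_gen_error n p \<nu> S \<theta> h \<le> 1"
    unfolding expected_gen_error_def using gen(2) space_TL
    by (intro TL.integral_le_const int) auto
  have "ennreal (expected_gen_error n p \<nu> S \<theta> h) = (\<integral>\<^sup>+D. ennreal (gen_error p S \<theta> h D) \<partial>?TL)"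
    unfolding expected_gen_error_def using gen0 by (intro nn_integral_eq_integral[symmetric] int) auto
  also have "\<dots> = (\<integral>\<^sup>+D. err D \<partial>?TL)"
    using gen(1) space_TL by (intro nn_integral_cong) auto
  also have "\<dots> = (\<integral>\<^sup>+x. err (?T x) \<partial>(\<nu> \<Otimes>\<^sub>M ?W))"
    unfolding training_law_def by (rule nn_integral_distr[OF T]) simp
  also have "\<dots> = (\<integral>\<^sup>+\<eta>. (\<integral>\<^sup>+W. err (?T (\<eta>, W)) \<partial>?W) \<partial>\<nu>)"
    by (rule W.nn_integral_fst[symmetric]) (rule measurable_compose[OF T err])
  finally show "ennreal (expected_gen_error n p \<nu> S \<theta> h)
      = (\<integral>\<^sup>+\<eta>. (\<integral>\<^sup>+W. ennreal (1 / 2) *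
          (label_error p S \<theta> h (-1) (\<lambda>i\<in>{..<n}. (observe p \<theta> (\<eta> i) (W i), \<eta> i))
            + label_error p S \<theta> h 1 (\<lambda>i\<in>{..<n}. (observe p \<theta> (\<eta> i) (W i), \<eta> i)))
          \<partial>?W) \<partial>\<nu>)"
    by (simp add: err_def)
qed

section \<open>The minimax lower bound\<close>

context diag_noise
begin

lemma gaussian_eq_noise: "gaussian p (mat_diag p v) = noise"
  unfolding noise_def by (rule gaussian_mat_diag[OF v_pos])

text \<open>
  For each label vector the testing bound controls the sum of the errors over all sign vectors.
  Integrating over the labels keeps the bound, and one of the \<open>2 ^ p\<close> sign vectors reaches the
  average.
\<close>

lemma exists_hard_center:
  assumes nn: "\<kappa> \<ge> 0" "d \<ge> 0" "b \<ge> 0"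
    and overlap: "\<And>x y. (\<And>j. j < p \<Longrightarrow> a j = 0 \<Longrightarrow> x j = 0 \<and> y j = 0) \<Longrightarrow>
      (\<Prod>j<p. cosh (x j) * cosh (y j))\<^sup>2 * exp (- 2 * cost \<kappa> d b x y)
        \<le> (\<Prod>j<p. cosh (x j + y j) * cosh (x j - y j))"
    and h: "h \<in> classifiers n p" and \<nu>: "prob_space \<nu>" "sets \<nu> = sets (labels_space n)"
  shows "\<exists>s\<in>signs. exp (- 2 * mean_cost \<kappa> d b a) / 4
    \<le> expected_gen_error n p \<nu> (mat_diag p v) (center a s) h"
proof -
  let ?S = "mat_diag p v" and ?N = "2 ^ p :: real"
  define B where "B = exp (- 2 * mean_cost \<kappa> d b a)"
  define data where "data \<eta> W = (\<lambda>i\<in>{..<n}. (W i, \<eta> i))"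
    for \<eta> :: "nat \<Rightarrow> real" and W :: "nat \<Rightarrow> nat \<Rightarrow> real"
  define F where "F \<eta> e z = (if h (data \<eta> (fst z), snd z) \<noteq> e then 1 else 0 :: ennreal)" for \<eta> e z
  define err where "err s \<eta> e = (\<integral>\<^sup>+W. label_error p ?S (center a s) h e
      (\<lambda>i\<in>{..<n}. (observe p (center a s) (\<eta> i) (W i), \<eta> i)) \<partial>noises)" for s \<eta> e
  interpret \<nu>: prob_space \<nu> by fact
  have S: "pos_def_mat p ?S"
    by (rule pos_def_mat_diag[OF v_pos])
  have noises: "(\<Pi>\<^sub>M i\<in>{..<n}. gaussian p ?S) = noises"
    by (simp add: gaussian_eq_noise noises_def)
  have lab: "\<eta> i \<in> {-1, 1}" if "\<eta> \<in> space \<nu>" "i < n" for \<eta> i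
  proof -
    have "space \<nu> = space (labels_space n)"
      by (rule sets_eq_imp_space_eq[OF \<nu>(2)])
    then show ?thesis
      using that by (auto simp: labels_space_def label_space_def space_PiM PiE_iff)
  qed
  have data: "(\<lambda>z. (data \<eta> (fst z), snd z)) \<in> measurable (noises \<Otimes>\<^sub>M noise) (data_space n p \<Otimes>\<^sub>M obs_space p)"
    if \<eta>: "\<eta> \<in> space \<nu>" for \<eta>
  proof (rule measurable_Pair)
    show "snd \<in> measurable (noises \<Otimes>\<^sub>M noise) (obs_space p)"
      by (simp cong: measurable_cong_sets add: sets_noise[symmetric])
    show "(\<lambda>z. data \<eta> (fst z)) \<in> measurable (noises \<Otimes>\<^sub>M noise) (data_space n p)"
      unfolding data_def data_space_def
    proof (intro measurable_restrict measurable_Pair)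
      fix i assume i: "i \<in> {..<n}"
      have "(\<lambda>z. fst z i) \<in> measurable (noises \<Otimes>\<^sub>M noise) noise"
        unfolding noises_def by (rule measurable_compose[OF measurable_fst measurable_component_singleton[OF i]])
      then show "(\<lambda>z. fst z i) \<in> measurable (noises \<Otimes>\<^sub>M noise) (obs_space p)"
        by (simp cong: measurable_cong_sets add: sets_noise)
      show "(\<lambda>z. \<eta> i) \<in> measurable (noises \<Otimes>\<^sub>M noise) label_space"
        using lab[OF \<eta>, of i] i by (intro measurable_const) (simp add: label_space_def)
    qed
  qed
  have F: "F \<eta> e \<in> borel_measurable (noises \<Otimes>\<^sub>M noise)" if "\<eta> \<in> space \<nu>" for \<eta> e
  proof -
    have [measurable]: "(\<lambda>z. h (data \<eta> (fst z), snd z)) \<in> borel_measurable (noises \<Otimes>\<^sub>M noise)"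
      by (rule measurable_compose[OF data[OF that] classifier_borel[OF h]])
    show ?thesis
      unfolding F_def[abs_def] by measurable
  qed
  have F1: "F \<eta> (-1) z + F \<eta> 1 z \<ge> 1" for \<eta> z
    by (auto simp: F_def)
  have err_eq: "err s \<eta> e
      = (\<integral>\<^sup>+z. F \<eta> e (observes (center a s) \<eta> (fst z), observe p (center a s) e (snd z)) \<partial>(noises \<Otimes>\<^sub>M noise))"
    if "\<eta> \<in> space \<nu>" for s \<eta> e
  proof -
    have d: "(\<lambda>i\<in>{..<n}. (observe p (center a s) (\<eta> i) (W i), \<eta> i)) = data \<eta> (observes (center a s) \<eta> W)" for W
      by (auto simp: data_def observes_def)
    have Fm: "F \<eta> e \<in> borel_measurable (noises \<Otimes>\<^sub>M noise)"
      by (rule F[OF that])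
    have shift: "(\<lambda>z. (observes (center a s) \<eta> (fst z), observe p (center a s) e (snd z)))
        \<in> measurable (noises \<Otimes>\<^sub>M noise) (noises \<Otimes>\<^sub>M noise)"
      by measurable
    have "err s \<eta> e = (\<integral>\<^sup>+W. (\<integral>\<^sup>+w. F \<eta> e (observes (center a s) \<eta> W, observe p (center a s) e w) \<partial>noise) \<partial>noises)"
      unfolding err_def label_error_def gaussian_eq_noise d F_def by simp
    also have "\<dots> = (\<integral>\<^sup>+z. F \<eta> e (observes (center a s) \<eta> (fst z), observe p (center a s) e (snd z)) \<partial>(noises \<Otimes>\<^sub>M noise))"
      using noise.nn_integral_fst[OF measurable_compose[OF shift Fm]] by simp
    finally show ?thesis .
  qed
  have lower: "ennreal (?N * B / 2) \<le> (\<Sum>s\<in>signs. err s \<eta> (-1) + err s \<eta> 1)" if \<eta>: "\<eta> \<in> space \<nu>" for \<eta>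
  proof -
    have sq: "(\<eta> i)\<^sup>2 = 1" if "i < n" for i
      using lab[OF \<eta> that] by auto
    have "ennreal (?N * B / 2) \<le> (\<Sum>e\<in>{-1, 1}. \<Sum>s\<in>signs.
        \<integral>\<^sup>+z. F \<eta> e (observes (center a s) \<eta> (fst z), observe p (center a s) e (snd z)) \<partial>(noises \<Otimes>\<^sub>M noise))"
      unfolding B_def
      by (rule mixture_test_error[OF nn sq overlap]) (use F[OF \<eta>] F1 in auto)
    then show ?thesis
      by (simp add: err_eq[OF \<eta>] sum.distrib)
  qed
  have train: "(\<lambda>x. label_error p ?S \<theta> h e (\<lambda>i\<in>{..<n}. (observe p \<theta> (fst x i) (snd x i), fst x i)))
      \<in> borel_measurable (\<nu> \<Otimes>\<^sub>M noises)" for \<theta> e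
    using measurable_compose[OF training_map_measurable[OF \<nu>(2), of p \<theta> ?S] label_error_measurable[OF h S, of \<theta> e]]
    by (simp add: noises split_beta')
  have err_meas: "(\<lambda>\<eta>. err s \<eta> e) \<in> borel_measurable \<nu>" for s e
    unfolding err_def using noises.borel_measurable_nn_integral[of "\<lambda>\<eta> W. label_error p ?S (center a s) h e
      (\<lambda>i\<in>{..<n}. (observe p (center a s) (\<eta> i) (W i), \<eta> i))" \<nu>] train[of "center a s" e]
    by (simp add: split_beta')
  have train_sect: "(\<lambda>W. label_error p ?S \<theta> h e (\<lambda>i\<in>{..<n}. (observe p \<theta> (\<eta> i) (W i), \<eta> i))) \<in> borel_measurable noises"
    if "\<eta> \<in> space \<nu>" for \<theta> e \<eta>
    using measurable_Pair2[OF train that, of \<theta> e] by simp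
  have risk: "ennreal (expected_gen_error n p \<nu> ?S (center a s) h)
      = (\<integral>\<^sup>+\<eta>. ennreal (1 / 2) * (err s \<eta> (-1) + err s \<eta> 1) \<partial>\<nu>)" for s
    unfolding expected_gen_error_eq(1)[OF h S \<nu>] noises
  proof (intro nn_integral_cong)
    fix \<eta> assume \<eta>: "\<eta> \<in> space \<nu>"
    show "(\<integral>\<^sup>+W. ennreal (1 / 2) *
        (label_error p ?S (center a s) h (-1) (\<lambda>i\<in>{..<n}. (observe p (center a s) (\<eta> i) (W i), \<eta> i))
        + label_error p ?S (center a s) h 1 (\<lambda>i\<in>{..<n}. (observe p (center a s) (\<eta> i) (W i), \<eta> i))) \<partial>noises)
      = ennreal (1 / 2) * (err s \<eta> (-1) + err s \<eta> 1)"
      unfolding err_def using train_sect[OF \<eta>]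
      by (subst nn_integral_cmult) (auto intro!: nn_integral_add arg_cong2[where f = "(*)"])
  qed
  have "ennreal (?N * B / 4) = ennreal (1 / 2) * ennreal (?N * B / 2)"
    by (subst ennreal_mult[symmetric]) (auto simp: B_def)
  also have "\<dots> = (\<integral>\<^sup>+\<eta>. ennreal (1 / 2) * ennreal (?N * B / 2) \<partial>\<nu>)"
    by (simp only: nn_integral_const \<nu>.emeasure_space_1 mult_1_right)
  also have "\<dots> \<le> (\<integral>\<^sup>+\<eta>. (\<Sum>s\<in>signs. ennreal (1 / 2) * (err s \<eta> (-1) + err s \<eta> 1)) \<partial>\<nu>)"
    unfolding sum_distrib_left[symmetric] by (intro nn_integral_mono mult_left_mono lower) auto
  also have "\<dots> = (\<Sum>s\<in>signs. \<integral>\<^sup>+\<eta>. ennreal (1 / 2) * (err s \<eta> (-1) + err s \<eta> 1) \<partial>\<nu>)"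
    by (intro nn_integral_sum borel_measurable_times_ennreal borel_measurable_add err_meas) auto
  also have "\<dots> = (\<Sum>s\<in>signs. ennreal (expected_gen_error n p \<nu> ?S (center a s) h))"
    by (simp add: risk)
  also have "\<dots> = ennreal (\<Sum>s\<in>signs. expected_gen_error n p \<nu> ?S (center a s) h)"
    by (intro sum_ennreal expected_gen_error_eq(2)[OF h S \<nu>])
  finally have sum: "?N * B / 4 \<le> (\<Sum>s\<in>signs. expected_gen_error n p \<nu> ?S (center a s) h)"
    by (subst (asm) ennreal_le_iff) (auto intro!: sum_nonneg expected_gen_error_eq(2)[OF h S \<nu>])
  show ?thesis
  proof (rule ccontr)
    assume "\<not> ?thesis"
    then have "expected_gen_error n p \<nu> ?S (center a s) h < B / 4" if "s \<in> signs" for s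
      using that by (force simp: B_def)
    moreover have "signs \<noteq> {}"
      using card_signs by (metis card.empty power_not_zero zero_neq_numeral)
    ultimately have "(\<Sum>s\<in>signs. expected_gen_error n p \<nu> ?S (center a s) h) < (\<Sum>s\<in>signs. B / 4)"
      by (intro sum_strict_mono finite_signs)
    then show False
      using sum by (simp add: card_signs)
  qed
qed

text \<open>
  The linear loss \<open>\<bar>y 0\<bar>\<close> is replaced by its quadratic majorant touching at \<open>\<bar>y 0\<bar> = t\<close>.
\<close>

lemma overlap_first_coordinate:
  assumes p: "p \<ge> 1" and t: "t > 0" and z: "\<And>j. j < p \<Longrightarrow> j \<noteq> 0 \<Longrightarrow> x j = 0 \<and> y j = 0"
  shows "(\<Prod>j<p. cosh (x j) * cosh (y j))\<^sup>2 * exp (- 2 * cost (t / 2) (1 / (2 * t)) 0 x y)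
    \<le> (\<Prod>j<p. cosh (x j + y j) * cosh (x j - y j :: real))"
proof -
  have p0: "{..<p} = insert 0 ({..<p} - {0})"
    using p by auto
  have prod0: "(\<Prod>j<p. f j) = f 0" if "\<And>j. j < p \<Longrightarrow> j \<noteq> 0 \<Longrightarrow> f j = 1" for f :: "nat \<Rightarrow> real"
    using that by (subst p0, subst prod.insert) (auto intro!: prod.neutral)
  have sum0: "(\<Sum>j<p. f j) = f 0" if "\<And>j. j < p \<Longrightarrow> j \<noteq> 0 \<Longrightarrow> f j = 0" for f :: "nat \<Rightarrow> real"
    using that by (subst p0, subst sum.insert) (auto intro!: sum.neutral)
  have "cost (t / 2) (1 / (2 * t)) 0 x y = t / 2 + (y 0)\<^sup>2 / (2 * t)"
    unfolding cost_def using z by (subst sum0) auto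
  moreover have "2 * \<bar>y 0\<bar> \<le> t + (y 0)\<^sup>2 / t"
  proof -
    have "0 \<le> (t - \<bar>y 0\<bar>)\<^sup>2 / t"
      using t by simp
    also have "\<dots> = t + (y 0)\<^sup>2 / t - 2 * \<bar>y 0\<bar>"
      using t by (simp add: power2_diff field_simps) (simp add: power2_eq_square)
    finally show ?thesis by simp
  qed
  ultimately have "exp (- 2 * cost (t / 2) (1 / (2 * t)) 0 x y) \<le> exp (- 2 * \<bar>y 0\<bar>)"
    by simp
  then have "(cosh (x 0) * cosh (y 0))\<^sup>2 * exp (- 2 * cost (t / 2) (1 / (2 * t)) 0 x y)
      \<le> (cosh (x 0) * cosh (y 0))\<^sup>2 * exp (- 2 * \<bar>y 0\<bar>)"
    by (rule mult_left_mono) simp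
  also note cosh_product_ge_abs
  finally show ?thesis
    using z by (subst (1 2) prod0) auto
qed

lemma overlap_all_coordinates:
  "(\<Prod>j<p. cosh (x j) * cosh (y j))\<^sup>2 * exp (- 2 * cost 0 0 3 x y)
    \<le> (\<Prod>j<p. cosh (x j + y j) * cosh (x j - y j :: real))"
proof -
  have "- 2 * cost 0 0 3 x y = (\<Sum>j<p. - 6 * ((x j)\<^sup>2 * (y j)\<^sup>2))"
    by (simp add: cost_def sum_distrib_left mult.assoc sum_negf)
  then have "(\<Prod>j<p. cosh (x j) * cosh (y j))\<^sup>2 * exp (- 2 * cost 0 0 3 x y)
      = (\<Prod>j<p. (cosh (x j) * cosh (y j))\<^sup>2 * exp (- 6 * ((x j)\<^sup>2 * (y j)\<^sup>2)))"
    by (simp only: exp_sum finite_lessThan prod_power_distrib prod.distrib power_mult_distrib)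
  also have "\<dots> \<le> (\<Prod>j<p. cosh (x j + y j) * cosh (x j - y j))"
    by (intro prod_mono conjI cosh_product_ge_square) auto
  finally show ?thesis .
qed

lemma center_in_center_class:
  assumes "s \<in> signs" "l \<le> (\<Sum>j<p. (a j)\<^sup>2)"
  shows "center a s \<in> center_class p l"
proof -
  have "(euclid_norm p (center a s))\<^sup>2 = (\<Sum>j<p. (center a s j)\<^sup>2)"
    by (simp add: euclid_norm_def L2_set_def sum_nonneg)
  also have "\<dots> = (\<Sum>j<p. (a j)\<^sup>2)"
    using sign_square[OF assms(1)] by (intro sum.cong) (auto simp: center_def power_mult_distrib)
  finally show ?thesis
    using assms(2) by (auto simp: center_class_def center_def)
qed

end

text \<open>
  Here the bound \<open>expected_gen_error n p \<nu> S \<theta> h \<le> 1\<close>, for all matrices of the class, makes the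
  suprema bounded from above.
\<close>

lemma minimax_ge_pointwise:
  assumes \<nu>: "prob_space \<nu>" "sets \<nu> = sets (labels_space n)"
    and S: "S \<in> cov_class p l r" and k: "center_class p k \<noteq> {}"
    and hard: "\<And>h. h \<in> classifiers n p \<Longrightarrow> \<exists>\<theta>\<in>center_class p k. c \<le> expected_gen_error n p \<nu> S \<theta> h"
  shows "c \<le> (INF h\<in>classifiers n p. SUP S\<in>cov_class p l r. SUP \<theta>\<in>center_class p k.
      expected_gen_error n p \<nu> S \<theta> h)"
proof (rule cINF_greatest)
  show "classifiers n p \<noteq> {}"
  proof -
    have "(\<lambda>_. 1) \<in> classifiers n p"
      by (auto simp: classifiers_def label_space_def)
    then show ?thesis by blast
  qed
  fix h assume h: "h \<in> classifiers n p"
  have le1: "expected_gen_error n p \<nu> S' \<theta> h \<le> 1" if "S' \<in> cov_class p l r" for S' \<theta>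
    using expected_gen_error_eq(3)[OF h _ \<nu>] that by (auto simp: cov_class_def)
  obtain \<theta> where \<theta>: "\<theta> \<in> center_class p k" "c \<le> expected_gen_error n p \<nu> S \<theta> h"
    using hard[OF h] by blast
  note \<theta>(2)
  also have "expected_gen_error n p \<nu> S \<theta> h \<le> (SUP \<theta>\<in>center_class p k. expected_gen_error n p \<nu> S \<theta> h)"
    using \<theta>(1) le1[OF S] by (intro cSUP_upper bdd_aboveI2[of _ _ 1])
  also have "\<dots> \<le> (SUP S\<in>cov_class p l r. SUP \<theta>\<in>center_class p k. expected_gen_error n p \<nu> S \<theta> h)"
  proof (intro cSUP_upper[OF S] bdd_aboveI2[of _ _ 1])
    fix S' assume "S' \<in> cov_class p l r"
    then show "(SUP \<theta>\<in>center_class p k. expected_gen_error n p \<nu> S' \<theta> h) \<le> 1"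
      using le1 k by (intro cSUP_least)
  qed
  finally show "c \<le> (SUP S\<in>cov_class p l r. SUP \<theta>\<in>center_class p k. expected_gen_error n p \<nu> S \<theta> h)" .
qed

theorem theorem2p1:
  shows "\<exists>c>0. \<exists>C>0. \<forall>n\<ge>1. \<forall>p\<ge>1. \<forall>\<nu> :: (nat \<Rightarrow> real) measure. \<forall>\<Delta> l r :: real.
    prob_space \<nu> \<longrightarrow> sets \<nu> = sets (labels_space n) \<longrightarrow>
    \<Delta> > 0 \<longrightarrow> l > 0 \<longrightarrow> r > 0 \<longrightarrow> cov_class p l r \<noteq> {} \<longrightarrow>
    (INF h\<in>classifiers n p. SUP S\<in>cov_class p l r. SUP \<theta>\<in>center_class p (\<Delta>\<^sup>2 * l).
        expected_gen_error n p \<nu> S \<theta> h)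
      \<ge> C * exp (- c * (\<Delta> ^ 4 / (\<Delta>\<^sup>2 + r / real n)))"
proof (rule exI[of _ 72], intro conjI, simp, rule exI[of _ "exp (-3) / 4"], intro conjI allI impI)
  show "(0 :: real) < exp (-3) / 4"
    by simp
  fix n p :: nat and \<nu> :: "(nat \<Rightarrow> real) measure" and \<Delta> l r :: real
  assume n: "n \<ge> 1" and p: "p \<ge> 1" and \<nu>: "prob_space \<nu>" "sets \<nu> = sets (labels_space n)"
    and \<Delta>: "\<Delta> > 0" and l: "l > 0" and r: "r > 0" and ne: "cov_class p l r \<noteq> {}"
  define mu where "mu = (if p = 1 then l else l * sqrt ((r - 1) / (real p - 1)))"
  define v where "v j = (if j = 0 then l else mu)" for j :: nat
  note spiked = spiked_diag_in_cov_class[OF p l ne, folded mu_def]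
  interpret diag_noise n p v
    by unfold_locales (use l spiked(3) in \<open>auto simp: v_def\<close>)
  have S: "mat_diag p v \<in> cov_class p l r"
    using spiked(5) by (simp add: v_def[abs_def])
  define E where "E = \<Delta> ^ 4 / (\<Delta>\<^sup>2 + r / real n)"
  have den: "\<Delta>\<^sup>2 + r / real n > 0"
    using \<Delta> r n by (intro add_pos_pos) auto
  have E0: "E \<ge> 0"
    unfolding E_def using den by simp
  have conclude: "(INF h\<in>classifiers n p. SUP S\<in>cov_class p l r. SUP \<theta>\<in>center_class p (\<Delta>\<^sup>2 * l).
        expected_gen_error n p \<nu> S \<theta> h) \<ge> exp (-3) / 4 * exp (- 72 * E)"
    if nn: "\<kappa> \<ge> 0" "d \<ge> 0" "b \<ge> 0" and a: "\<Delta>\<^sup>2 * l \<le> (\<Sum>j<p. (a j)\<^sup>2)"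
      and cost: "2 * mean_cost \<kappa> d b a \<le> 3 + 72 * E"
      and overlap: "\<And>x y. (\<And>j. j < p \<Longrightarrow> a j = 0 \<Longrightarrow> x j = 0 \<and> y j = 0) \<Longrightarrow>
        (\<Prod>j<p. cosh (x j) * cosh (y j))\<^sup>2 * exp (- 2 * cost \<kappa> d b x y)
          \<le> (\<Prod>j<p. cosh (x j + y j) * cosh (x j - y j))"
    for \<kappa> d b a
  proof (rule minimax_ge_pointwise[OF \<nu> S])
    have "signs \<noteq> {}"
      using card_signs by (metis card.empty power_not_zero zero_neq_numeral)
    then show "center_class p (\<Delta>\<^sup>2 * l) \<noteq> {}"
      using center_in_center_class[OF _ a] by blast
    fix h assume h: "h \<in> classifiers n p"
    obtain s where s: "s \<in> signs"
      and err: "exp (- 2 * mean_cost \<kappa> d b a) / 4 \<le> expected_gen_error n p \<nu> (mat_diag p v) (center a s) h"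
      using exists_hard_center[OF nn overlap h \<nu>] by blast
    have "exp (-3) / 4 * exp (- 72 * E) = exp (- (3 + 72 * E)) / 4"
      by (simp add: exp_add[symmetric])
    also have "\<dots> \<le> exp (- 2 * mean_cost \<kappa> d b a) / 4"
      using cost by simp
    also note err
    finally show "\<exists>\<theta>\<in>center_class p (\<Delta>\<^sup>2 * l).
        exp (-3) / 4 * exp (- 72 * E) \<le> expected_gen_error n p \<nu> (mat_diag p v) \<theta> h"
      using center_in_center_class[OF s a] by blast
  qed
  show "exp (-3) / 4 * exp (- 72 * (\<Delta> ^ 4 / (\<Delta>\<^sup>2 + r / real n)))
    \<le> (INF h\<in>classifiers n p. SUP S\<in>cov_class p l r. SUP \<theta>\<in>center_class p (\<Delta>\<^sup>2 * l).
        expected_gen_error n p \<nu> S \<theta> h)"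
    unfolding E_def[symmetric]
  proof (cases "r \<ge> 2 \<and> r \<ge> 2 * n * \<Delta>\<^sup>2")
    case False
    \<comment> \<open>The center lies on the first axis.  The value of \<open>t\<close> majorises the root mean square
      \<open>\<Delta> * sqrt t\<close> of \<open>y 0\<close>, which makes the quadratic majorant of \<open>\<bar>y 0\<bar>\<close> almost sharp.\<close>
    define a where "a j = (if j = 0 then \<Delta> * sqrt l else 0)" for j :: nat
    define t where "t = \<Delta>\<^sup>2 + 1"
    have t: "t > 0"
      by (simp add: t_def add_nonneg_pos)
    have sum0: "(\<Sum>j<p. f j) = f 0" if "\<And>j. j \<noteq> 0 \<Longrightarrow> f j = 0" for f :: "nat \<Rightarrow> real"
      using that p by (subst sum.mono_neutral_right[of _ "{0}"]) auto
    show "exp (-3) / 4 * exp (- 72 * E)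
      \<le> (INF h\<in>classifiers n p. SUP S\<in>cov_class p l r. SUP \<theta>\<in>center_class p (\<Delta>\<^sup>2 * l).
          expected_gen_error n p \<nu> S \<theta> h)"
    proof (rule conclude[of "t / 2" "1 / (2 * t)" 0 a])
      show "\<Delta>\<^sup>2 * l \<le> (\<Sum>j<p. (a j)\<^sup>2)"
        using l by (subst sum0) (auto simp: a_def power_mult_distrib)
      have "mean_cost (t / 2) (1 / (2 * t)) 0 a = t / 2 + 1 / (2 * t) * ((\<Delta> * sqrt l / l)\<^sup>2 * ((\<Delta> * sqrt l)\<^sup>2 + l))"
        unfolding mean_cost_def by (subst sum0) (auto simp: a_def v_def)
      also have "(\<Delta> * sqrt l / l)\<^sup>2 * ((\<Delta> * sqrt l)\<^sup>2 + l) = \<Delta>\<^sup>2 * t"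
        using l by (simp add: t_def power_mult_distrib power_divide field_simps power2_eq_square)
      also have "t / 2 + 1 / (2 * t) * (\<Delta>\<^sup>2 * t) = \<Delta>\<^sup>2 + 1 / 2"
        using t by (simp add: t_def field_simps)
      finally have m: "mean_cost (t / 2) (1 / (2 * t)) 0 a = \<Delta>\<^sup>2 + 1 / 2" .
      have "2 * \<Delta>\<^sup>2 \<le> 2 + 72 * E"
      proof (cases "r < 2 * n * \<Delta>\<^sup>2")
        case True
        then have "\<Delta>\<^sup>2 + r / real n \<le> 3 * \<Delta>\<^sup>2"
          using n by (simp add: field_simps)
        then have "\<Delta> ^ 4 / (3 * \<Delta>\<^sup>2) \<le> E"
          unfolding E_def using den \<Delta> by (intro divide_left_mono mult_pos_pos) auto
        moreover have "\<Delta> ^ 4 / (3 * \<Delta>\<^sup>2) = \<Delta>\<^sup>2 / 3"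
          using \<Delta> by (simp add: field_simps power2_eq_square power4_eq_xxxx)
        ultimately show ?thesis
          using E0 by simp
      next
        case F: False
        then have "r < 2"
          using False by auto
        then have "2 * n * \<Delta>\<^sup>2 < 2"
          using F by simp
        moreover have "1 * \<Delta>\<^sup>2 \<le> n * \<Delta>\<^sup>2"
          using n by (intro mult_right_mono) auto
        ultimately show ?thesis
          using E0 by simp
      qed
      then show "2 * mean_cost (t / 2) (1 / (2 * t)) 0 a \<le> 3 + 72 * E"
        unfolding m by simp
    next
      fix x y :: "nat \<Rightarrow> real"
      assume "\<And>j. j < p \<Longrightarrow> a j = 0 \<Longrightarrow> x j = 0 \<and> y j = 0"
      then show "(\<Prod>j<p. cosh (x j) * cosh (y j))\<^sup>2 * exp (- 2 * cost (t / 2) (1 / (2 * t)) 0 x y)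
          \<le> (\<Prod>j<p. cosh (x j + y j) * cosh (x j - y j))"
        by (intro overlap_first_coordinate p t) (auto simp: a_def)
    qed (use t in auto)
  next
    case True
    then have r2: "r \<ge> 2" "2 * n * \<Delta>\<^sup>2 \<le> r"
      by auto
    have p2: "p \<ge> 2"
      using spiked(1) p r2 by (cases "p = 1") auto
    define q where "q = real p - 1"
    have q: "q > 0" "real (card {1..<p}) = q"
      using p2 by (auto simp: q_def)
    \<comment> \<open>The center has equal coordinates, up to sign, outside the first one.  Leaving out the first
      coordinate costs only the replacement of \<open>r\<close> by \<open>r - 1\<close>, harmless since \<open>r \<ge> 2\<close>.\<close>
    define a where "a j = (if j = 0 then 0 else \<Delta> * sqrt (l / q))" for j :: nat
    have mu: "mu > 0" "mu \<le> l" "mu * mu * q = l * l * (r - 1)"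
    proof -
      have "sqrt ((r - 1) / q) * sqrt ((r - 1) / q) = (r - 1) / q"
        using r2 q by (simp only: real_sqrt_mult_self) simp
      moreover have "mu * mu = l * l * (sqrt ((r - 1) / q) * sqrt ((r - 1) / q))"
        using p2 by (simp add: mu_def q_def mult_ac)
      ultimately show "mu * mu * q = l * l * (r - 1)"
        using q by simp
    qed (use spiked in auto)
    have sum_tail: "(\<Sum>j<p. f j) = q * c" if "f 0 = 0" "\<And>j. j \<noteq> 0 \<Longrightarrow> f j = c" for f :: "nat \<Rightarrow> real" and c
    proof -
      have "(\<Sum>j<p. f j) = (\<Sum>j\<in>{1..<p}. f j)"
        using that by (intro sum.mono_neutral_right) (auto simp: not_less_eq_eq Suc_le_eq)
      also have "\<dots> = (\<Sum>j\<in>{1..<p}. c)"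
        using that by (intro sum.cong) auto
      finally show ?thesis
        using q(2) by simp
    qed
    show "exp (-3) / 4 * exp (- 72 * E)
      \<le> (INF h\<in>classifiers n p. SUP S\<in>cov_class p l r. SUP \<theta>\<in>center_class p (\<Delta>\<^sup>2 * l).
          expected_gen_error n p \<nu> S \<theta> h)"
    proof (rule conclude[of 0 0 3 a])
      define A where "A = \<Delta>\<^sup>2 * (l / q)"
      \<comment> \<open>The signal to noise ratio per coordinate.  In this regime even \<open>n * \<xi>\<close> is at most one, so
        that the second moments are dominated by their noise parts.\<close>
      define \<xi> where "\<xi> = A / mu"
      have a2: "(a j)\<^sup>2 = A" if "j \<noteq> 0" for j
        using that l q by (simp add: a_def A_def power_mult_distrib)
      show "\<Delta>\<^sup>2 * l \<le> (\<Sum>j<p. (a j)\<^sup>2)"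
        using q a2 by (subst sum_tail[of _ A]) (auto simp: a_def A_def)
      have \<xi>0: "\<xi> \<ge> 0"
        using l q mu by (simp add: \<xi>_def A_def)
      have "2 * n * \<Delta>\<^sup>2 = 2 * (\<Delta>\<^sup>2 * n)"
        by simp
      then have "\<Delta>\<^sup>2 * n \<le> r - 1"
        using r2 by linarith
      then have "\<Delta>\<^sup>2 * n * (l * l) \<le> (r - 1) * (l * l)"
        by (intro mult_right_mono) auto
      also have "\<dots> = mu * mu * q"
        using mu by simp
      also have "\<dots> \<le> l * mu * q"
        using mu q by (intro mult_right_mono) auto
      finally have "l * (\<Delta>\<^sup>2 * n * l) \<le> l * (mu * q)"
        by (simp add: mult_ac)
      then have "\<Delta>\<^sup>2 * n * l \<le> mu * q"
        using l by simp
      then have n\<xi>: "n * \<xi> \<le> 1"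
        using mu q by (simp add: \<xi>_def A_def field_simps)
      have "1 * \<xi> \<le> n * \<xi>"
        using n \<xi>0 by (intro mult_right_mono) auto
      then have \<xi>1: "\<xi> \<le> 1"
        using n\<xi> by simp
      have "mean_cost 0 0 3 a = q * (3 * (((real n)\<^sup>2 * \<xi>\<^sup>2 + n * \<xi>) * (\<xi>\<^sup>2 + \<xi>)))"
        unfolding mean_cost_def
      proof (simp only: add_0_left, rule sum_tail)
        fix j :: nat assume j: "j \<noteq> 0"
        have vj: "v j = mu"
          using j by (simp add: v_def)
        have 1: "(a j / v j)\<^sup>2 * ((real n)\<^sup>2 * (a j)\<^sup>2 + n * v j) = (real n)\<^sup>2 * \<xi>\<^sup>2 + n * \<xi>"
          unfolding power_divide a2[OF j] vj \<xi>_def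
          using mu(1) by (simp add: field_simps power2_eq_square)
        have 2: "(a j / v j)\<^sup>2 * ((a j)\<^sup>2 + v j) = \<xi>\<^sup>2 + \<xi>"
          unfolding power_divide a2[OF j] vj \<xi>_def
          using mu(1) by (simp add: field_simps power2_eq_square)
        show "3 * ((a j / v j)\<^sup>2 * ((real n)\<^sup>2 * (a j)\<^sup>2 + n * v j)) * ((a j / v j)\<^sup>2 * ((a j)\<^sup>2 + v j))
          = 3 * (((real n)\<^sup>2 * \<xi>\<^sup>2 + n * \<xi>) * (\<xi>\<^sup>2 + \<xi>))"
          unfolding 1 2 by simp
      qed (simp add: a_def)
      also have "\<dots> \<le> q * (3 * ((2 * (n * \<xi>)) * (2 * \<xi>)))"
      proof -
        have "(n * \<xi>) * (n * \<xi>) \<le> (n * \<xi>) * 1" "\<xi> * \<xi> \<le> \<xi> * 1"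
          using n\<xi> \<xi>1 \<xi>0 by (intro mult_left_mono; simp)+
        then have "(real n)\<^sup>2 * \<xi>\<^sup>2 + n * \<xi> \<le> 2 * (n * \<xi>)" "\<xi>\<^sup>2 + \<xi> \<le> 2 * \<xi>"
          by (auto simp: power2_eq_square mult_ac)
        then show ?thesis
          using q \<xi>0 by (intro mult_left_mono mult_mono) auto
      qed
      also have "\<dots> = 12 * n * (q * \<xi>\<^sup>2)"
        by (simp add: power2_eq_square)
      also have "q * \<xi>\<^sup>2 = \<Delta> ^ 4 / (r - 1)"
      proof -
        have "q * \<xi>\<^sup>2 = \<Delta> ^ 4 * (l * l) / (mu * mu * q)"
          using q mu(1) by (simp add: \<xi>_def A_def field_simps power2_eq_square power4_eq_xxxx)
        then show ?thesis
          using l unfolding mu(3) by simp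
      qed
      also have "12 * n * (\<Delta> ^ 4 / (r - 1)) \<le> 36 * E"
      proof -
        have scale: "12 * u \<le> 36 * E" if "u / 3 \<le> E" for u
          using that by simp
        have "n * \<Delta>\<^sup>2 + r \<le> 3 * (r - 1)"
        proof -
          define u where "u = n * \<Delta>\<^sup>2"
          have "2 * u \<le> r"
            using r2(2) by (simp add: u_def mult_ac)
          then have "u + r \<le> 3 * (r - 1)"
            using r2(1) by simp
          then show ?thesis
            by (simp only: u_def)
        qed
        then have "(n * \<Delta>\<^sup>2 + r) / n \<le> 3 * (r - 1) / n"
          by (intro divide_right_mono) auto
        then have "\<Delta>\<^sup>2 + r / real n \<le> 3 * (r - 1) / real n"
          using n by (simp add: add_divide_distrib)
        then have "\<Delta> ^ 4 / (3 * (r - 1) / real n) \<le> E"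
          unfolding E_def using den r2(1) n by (intro divide_left_mono mult_pos_pos divide_pos_pos) auto
        moreover have "\<Delta> ^ 4 / (3 * (r - 1) / real n) = n * (\<Delta> ^ 4 / (r - 1)) / 3"
          by (simp add: mult_ac)
        ultimately have "n * (\<Delta> ^ 4 / (r - 1)) / 3 \<le> E"
          by (simp only:)
        then have "12 * (n * (\<Delta> ^ 4 / (r - 1))) \<le> 36 * E"
          by (rule scale)
        then show ?thesis
          by (simp add: mult_ac)
      qed
      finally show "2 * mean_cost 0 0 3 a \<le> 3 + 72 * E"
        by simp
    qed (rule overlap_all_coordinates | simp)+
  qed
qed

end
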